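(* Let $\mathcal{M}$ be a lunar monoid, i.e. a cancellative monoid such that for all $a,b,c,d,x,y,z,w\in\mathcal{M}$, $$\big(ax=by,\ cx=dy,\ az=bw\big)\Longrightarrow cz=dw .$$ Then the Hankel system $\{\Gamma_t^{\mathcal{M}}\}_{t\in\mathcal{M}}\subset B(\ell^2(\mathcal{M}))$ has the self-absorption property (SAP).
   Context: A monoid is a semigroup with unit (not necessarily commutative); it is cancellative if $abc=adc$ implies $b=d$. Hankel system: for a cancellative monoid $\mathcal{M}$ and $t\in\mathcal{M}$, $\Gamma_t^{\mathcal{M}}\in B(\ell^2(\mathcal{M}))$ is the operator whose matrix in the canonical orthonormal basis is $\Gamma_t^{\mathcal{M}}(s_1,s_2)=1$ if $s_1s_2=t$ and $0$ otherwise ($s_1,s_2\in\mathcal{M}$). SAP: a family $\{x_i\}_{i\in I}$ in a $C^*$-algebra $A$ has the self-absorption property (SAP) if for every $C^*$-algebra $B$ and every finitely supported family $(b_i)_{i\in I}$ in $B$, $$\Big\|\sum_{i} b_i\otimes x_i\Big\|_{B\otimes_{\min}A}=\Big\|\sum_{i} b_i\otimes x_i\otimes\overline{x}_i\Big\|_{B\otimes_{\min}A\otimes_{\min}\overline{A}} .$$ Here $\otimes_{\min}$ is the minimal tensor product, $\overline{A}$ is the complex conjugate $C^*$-algebra of $A$ (same elements, product, involution and norm, conjugate scalar multiplication) and $\overline{x}$ is $x$ viewed in $\overline{A}$. For $A=B(\ell^2(S))$, $\overline{A}$ is identified with $B(\ell^2(S))$ so that $\overline{x}$ is the entrywise complex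 conjugate matrix of $x$. *)

theory Defs
  imports "HOL-Analysis.Analysis"
begin

section \<open>Complex normed spaces and C*-algebras\<close>

class complex_normed_vector = real_normed_vector +
  fixes scaleC :: "complex \<Rightarrow> 'a \<Rightarrow> 'a" (infixr \<open>*\<^sub>C\<close> 75)
  assumes scaleC_add_right: "c *\<^sub>C (x + y) = c *\<^sub>C x + c *\<^sub>C y"
    and scaleC_add_left: "(c + d) *\<^sub>C x = c *\<^sub>C x + d *\<^sub>C x"
    and scaleC_scaleC: "c *\<^sub>C (d *\<^sub>C x) = (c * d) *\<^sub>C x"
    and scaleR_scaleC: "scaleR r x = complex_of_real r *\<^sub>C x"
    and norm_scaleC: "norm (c *\<^sub>C x) = cmod c * norm x"

text \<open>C*-algebras need neither be unital nor nonzero.\<close>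

class cstar_algebra = complex_normed_vector + real_normed_algebra + complete_space +
  fixes star :: "'a \<Rightarrow> 'a"
  assumes mult_scaleC_left: "(c *\<^sub>C x) * y = c *\<^sub>C (x * y)"
    and mult_scaleC_right: "x * (c *\<^sub>C y) = c *\<^sub>C (x * y)"
    and star_add: "star (x + y) = star x + star y"
    and star_scaleC: "star (c *\<^sub>C x) = cnj c *\<^sub>C star x"
    and star_mult: "star (x * y) = star y * star x"
    and star_star: "star (star x) = x"
    and norm_star_mult_self: "norm (star x * x) = (norm x)\<^sup>2"

subclass (in cstar_algebra) banach ..

section \<open>The complex conjugate of a C*-algebra\<close>

typedef 'a cconj = "UNIV :: 'a set"
  morphisms of_cconj to_cconj ..

setup_lifting type_definition_cconj

instantiation cconj :: (cstar_algebra) real_vector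
begin

lift_definition zero_cconj :: "'a cconj" is 0 .
lift_definition plus_cconj :: "'a cconj \<Rightarrow> 'a cconj \<Rightarrow> 'a cconj" is "(+)" .
lift_definition minus_cconj :: "'a cconj \<Rightarrow> 'a cconj \<Rightarrow> 'a cconj" is "(-)" .
lift_definition uminus_cconj :: "'a cconj \<Rightarrow> 'a cconj" is uminus .
lift_definition scaleR_cconj :: "real \<Rightarrow> 'a cconj \<Rightarrow> 'a cconj" is scaleR .

instance
proof
  fix x y z :: "'a cconj" and r s :: real
  show "x + y + z = x + (y + z)" by transfer (rule add.assoc)
  show "x + y = y + x" by transfer (rule add.commute)
  show "0 + x = x" by transfer simp
  show "- x + x = 0" by transfer simp
  show "x - y = x + - y" by transfer simp
  show "r *\<^sub>R (x + y) = r *\<^sub>R x + r *\<^sub>R y" by transfer (rule scaleR_add_right)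
  show "(r + s) *\<^sub>R x = r *\<^sub>R x + s *\<^sub>R x" by transfer (rule scaleR_add_left)
  show "r *\<^sub>R s *\<^sub>R x = (r * s) *\<^sub>R x" by transfer simp
  show "1 *\<^sub>R x = x" by transfer simp
qed

end

instantiation cconj :: (cstar_algebra) complex_normed_vector
begin

lift_definition scaleC_cconj :: "complex \<Rightarrow> 'a cconj \<Rightarrow> 'a cconj" is "\<lambda>c x. cnj c *\<^sub>C x" .
lift_definition norm_cconj :: "'a cconj \<Rightarrow> real" is norm .
definition sgn_cconj :: "'a cconj \<Rightarrow> 'a cconj" where "sgn_cconj x = inverse (norm x) *\<^sub>R x"
definition dist_cconj :: "'a cconj \<Rightarrow> 'a cconj \<Rightarrow> real" where "dist_cconj x y = norm (x - y)"
definition uniformity_cconj :: "('a cconj \<times> 'a cconj) filter"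
  where "uniformity_cconj = (INF e\<in>{0<..}. principal {(x, y). dist x y < e})"
definition open_cconj :: "'a cconj set \<Rightarrow> bool"
  where "open_cconj U = (\<forall>x\<in>U. eventually (\<lambda>(x', y). x' = x \<longrightarrow> y \<in> U) uniformity)"

instance
proof
  fix x y z :: "'a cconj" and r s :: real and c d :: complex
  show "sgn x = x /\<^sub>R norm x" by (rule sgn_cconj_def)
  show "dist x y = norm (x - y)" by (rule dist_cconj_def)
  show "uniformity = (INF e\<in>{0<..}. principal {(x::'a cconj, y). dist x y < e})"
    by (rule uniformity_cconj_def)
  show "open U = (\<forall>x\<in>U. eventually (\<lambda>(x', y). x' = x \<longrightarrow> y \<in> U) uniformity)"
    for U :: "'a cconj set" by (rule open_cconj_def)
  show "(norm x = 0) = (x = 0)" by transfer simp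
  show "norm (x + y) \<le> norm x + norm y" by transfer (rule norm_triangle_ineq)
  show "norm (r *\<^sub>R x) = \<bar>r\<bar> * norm x" by transfer simp
  show "c *\<^sub>C (x + y) = c *\<^sub>C x + c *\<^sub>C y" by transfer (rule scaleC_add_right)
  show "(c + d) *\<^sub>C x = c *\<^sub>C x + d *\<^sub>C x" by transfer (simp add: scaleC_add_left)
  show "c *\<^sub>C (d *\<^sub>C x) = (c * d) *\<^sub>C x" by transfer (simp add: scaleC_scaleC)
  show "r *\<^sub>R x = complex_of_real r *\<^sub>C x" by transfer (simp add: scaleR_scaleC)
  show "norm (c *\<^sub>C x) = cmod c * norm x" by transfer (simp add: norm_scaleC)
qed

end

instantiation cconj :: (cstar_algebra) cstar_algebra
begin

lift_definition times_cconj :: "'a cconj \<Rightarrow> 'a cconj \<Rightarrow> 'a cconj" is "(*)" .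
lift_definition star_cconj :: "'a cconj \<Rightarrow> 'a cconj" is star .

instance
proof
  fix x y z :: "'a cconj" and r :: real and c :: complex
  show "x * y * z = x * (y * z)" by transfer (rule mult.assoc)
  show "(x + y) * z = x * z + y * z" by transfer (rule distrib_right)
  show "x * (y + z) = x * y + x * z" by transfer (rule distrib_left)
  show "r *\<^sub>R x * y = r *\<^sub>R (x * y)" by transfer simp
  show "x * r *\<^sub>R y = r *\<^sub>R (x * y)" by transfer simp
  show "norm (x * y) \<le> norm x * norm y" by transfer (rule norm_mult_ineq)
  show "(c *\<^sub>C x) * y = c *\<^sub>C (x * y)" by transfer (rule mult_scaleC_left)
  show "x * (c *\<^sub>C y) = c *\<^sub>C (x * y)" by transfer (rule mult_scaleC_right)
  show "star (x + y) = star x + star y" by transfer (rule star_add)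
  show "star (c *\<^sub>C x) = cnj c *\<^sub>C star x" by transfer (simp add: star_scaleC)
  show "star (x * y) = star y * star x" by transfer (rule star_mult)
  show "star (star x) = x" by transfer (rule star_star)
  show "norm (star x * x) = (norm x)\<^sup>2" by transfer (rule norm_star_mult_self)
next
  fix X :: "nat \<Rightarrow> 'a cconj" assume "Cauchy X"
  have d: "dist x y = dist (of_cconj x) (of_cconj y)" for x y :: "'a cconj"
    unfolding dist_cconj_def dist_norm by transfer simp
  have "Cauchy (\<lambda>n. of_cconj (X n))"
    using \<open>Cauchy X\<close> unfolding Cauchy_def d .
  then obtain l where "(\<lambda>n. of_cconj (X n)) \<longlonglongrightarrow> l"
    using Cauchy_convergent convergent_def by blast
  then have "X \<longlonglongrightarrow> to_cconj l"
    unfolding lim_sequentially d by (simp add: to_cconj_inverse)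
  then show "convergent X" by (auto simp: convergent_def)
qed

end

section \<open>The Hilbert space of square-summable functions\<close>

typedef 'a ell2 = "{f :: 'a \<Rightarrow> complex. (\<lambda>i. (cmod (f i))\<^sup>2) summable_on UNIV}"
  morphisms ell2_apply Abs_ell2
  by (rule exI[of _ "\<lambda>_. 0"]) simp

setup_lifting type_definition_ell2

lemma square_summable_add:
  assumes "(\<lambda>i. (cmod (f i))\<^sup>2) summable_on UNIV" "(\<lambda>i. (cmod (g i))\<^sup>2) summable_on UNIV"
  shows "(\<lambda>i. (cmod (f i + g i))\<^sup>2) summable_on UNIV"
proof (rule summable_on_comparison_test)
  show "(\<lambda>i. 2 * (cmod (f i))\<^sup>2 + 2 * (cmod (g i))\<^sup>2) summable_on UNIV"
    by (intro summable_on_add summable_on_cmult_right assms)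
  fix i
  have "(cmod (f i + g i))\<^sup>2 \<le> (cmod (f i) + cmod (g i))\<^sup>2"
    by (simp add: norm_triangle_ineq power_mono)
  also have "\<dots> \<le> 2 * (cmod (f i))\<^sup>2 + 2 * (cmod (g i))\<^sup>2"
    using sum_squares_bound[of "cmod (f i)" "cmod (g i)"] by (simp add: power2_sum)
  finally show "(cmod (f i + g i))\<^sup>2 \<le> 2 * (cmod (f i))\<^sup>2 + 2 * (cmod (g i))\<^sup>2" .
qed simp

lemma square_summable_cmult:
  assumes "(\<lambda>i. (cmod (f i))\<^sup>2) summable_on UNIV"
  shows "(\<lambda>i. (cmod (c * f i))\<^sup>2) summable_on UNIV"
  using summable_on_cmult_right[OF assms, of "(cmod c)\<^sup>2"]
  by (simp add: norm_mult power_mult_distrib)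

lemma ell2_square_summable: "(\<lambda>i. (cmod (ell2_apply x i))\<^sup>2) summable_on UNIV"
  using ell2_apply[of x] by simp

lemma ell2_abs_summable_mult:
  "(\<lambda>i. cmod (ell2_apply x i) * cmod (ell2_apply y i)) summable_on UNIV"
proof (rule summable_on_comparison_test)
  show "(\<lambda>i. (cmod (ell2_apply x i))\<^sup>2 + (cmod (ell2_apply y i))\<^sup>2) summable_on UNIV"
    by (intro summable_on_add ell2_square_summable)
  fix i
  show "cmod (ell2_apply x i) * cmod (ell2_apply y i)
      \<le> (cmod (ell2_apply x i))\<^sup>2 + (cmod (ell2_apply y i))\<^sup>2"
    using sum_squares_bound[of "cmod (ell2_apply x i)" "cmod (ell2_apply y i)"]
      zero_le_power2[of "cmod (ell2_apply x i)"] zero_le_power2[of "cmod (ell2_apply y i)"]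
      mult_nonneg_nonneg[OF norm_ge_zero norm_ge_zero, of "ell2_apply x i" "ell2_apply y i"] 
    by linarith
qed simp

lemma ell2_inner_summable: "(\<lambda>i. inner (ell2_apply x i) (ell2_apply y i)) summable_on UNIV"
proof -
  have "(\<lambda>i. norm (inner (ell2_apply x i) (ell2_apply y i))) summable_on UNIV"
    by (rule summable_on_comparison_test[OF ell2_abs_summable_mult[of x y]])
       (auto simp: Cauchy_Schwarz_ineq2)
  then show ?thesis by (rule abs_summable_summable)
qed

lemma ell2_cinner_summable: "(\<lambda>i. cnj (ell2_apply x i) * ell2_apply y i) summable_on UNIV"
proof -
  have "(\<lambda>i. norm (cnj (ell2_apply x i) * ell2_apply y i)) summable_on UNIV"
    using ell2_abs_summable_mult[of x y] by (simp add: norm_mult)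
  then show ?thesis by (rule abs_summable_summable)
qed

instantiation ell2 :: (type) real_vector
begin

lift_definition zero_ell2 :: "'a ell2" is "\<lambda>_. 0" by simp
lift_definition plus_ell2 :: "'a ell2 \<Rightarrow> 'a ell2 \<Rightarrow> 'a ell2" is "\<lambda>f g i. f i + g i"
  by (rule square_summable_add)
lift_definition uminus_ell2 :: "'a ell2 \<Rightarrow> 'a ell2" is "\<lambda>f i. - f i" by simp
lift_definition minus_ell2 :: "'a ell2 \<Rightarrow> 'a ell2 \<Rightarrow> 'a ell2" is "\<lambda>f g i. f i - g i"
proof -
  fix f g :: "'a \<Rightarrow> complex"
  assume "(\<lambda>i. (cmod (f i))\<^sup>2) summable_on UNIV" "(\<lambda>i. (cmod (g i))\<^sup>2) summable_on UNIV"
  then show "(\<lambda>i. (cmod (f i - g i))\<^sup>2) summable_on UNIV"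
    using square_summable_add[of f "\<lambda>i. - g i"] by simp
qed
lift_definition scaleR_ell2 :: "real \<Rightarrow> 'a ell2 \<Rightarrow> 'a ell2"
  is "\<lambda>r f i. complex_of_real r * f i" by (rule square_summable_cmult)

instance
proof
  fix x y z :: "'a ell2" and r s :: real
  show "x + y + z = x + (y + z)" by transfer (simp add: add.assoc)
  show "x + y = y + x" by transfer (simp add: add.commute)
  show "0 + x = x" by transfer simp
  show "- x + x = 0" by transfer simp
  show "x - y = x + - y" by transfer simp
  show "r *\<^sub>R (x + y) = r *\<^sub>R x + r *\<^sub>R y" by transfer (simp add: ring_distribs)
  show "(r + s) *\<^sub>R x = r *\<^sub>R x + s *\<^sub>R x" by transfer (simp add: ring_distribs)
  show "r *\<^sub>R s *\<^sub>R x = (r * s) *\<^sub>R x" by transfer (simp add: mult.assoc)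
  show "1 *\<^sub>R x = x" by transfer simp
qed

end

instantiation ell2 :: (type) real_inner
begin

definition inner_ell2 :: "'a ell2 \<Rightarrow> 'a ell2 \<Rightarrow> real"
  where "inner_ell2 x y = (\<Sum>\<^sub>\<infinity>i. inner (ell2_apply x i) (ell2_apply y i))"
definition norm_ell2 :: "'a ell2 \<Rightarrow> real"
  where "norm_ell2 x = sqrt (\<Sum>\<^sub>\<infinity>i. (cmod (ell2_apply x i))\<^sup>2)"
definition sgn_ell2 :: "'a ell2 \<Rightarrow> 'a ell2" where "sgn_ell2 x = inverse (norm x) *\<^sub>R x"
definition dist_ell2 :: "'a ell2 \<Rightarrow> 'a ell2 \<Rightarrow> real" where "dist_ell2 x y = norm (x - y)"
definition uniformity_ell2 :: "('a ell2 \<times> 'a ell2) filter"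
  where "uniformity_ell2 = (INF e\<in>{0<..}. principal {(x, y). dist x y < e})"
definition open_ell2 :: "'a ell2 set \<Rightarrow> bool"
  where "open_ell2 U = (\<forall>x\<in>U. eventually (\<lambda>(x', y). x' = x \<longrightarrow> y \<in> U) uniformity)"

instance
proof
  fix x y z :: "'a ell2" and r s :: real
  show "sgn x = x /\<^sub>R norm x" by (rule sgn_ell2_def)
  show "dist x y = norm (x - y)" by (rule dist_ell2_def)
  show "uniformity = (INF e\<in>{0<..}. principal {(x::'a ell2, y). dist x y < e})"
    by (rule uniformity_ell2_def)
  show "open U = (\<forall>x\<in>U. eventually (\<lambda>(x', y). x' = x \<longrightarrow> y \<in> U) uniformity)"
    for U :: "'a ell2 set" by (rule open_ell2_def)
  show "inner x y = inner y x" by (simp add: inner_ell2_def inner_commute)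
  show "inner (x + y) z = inner x z + inner y z"
    unfolding inner_ell2_def
    by (subst infsum_add[symmetric])
       (auto simp: ell2_inner_summable plus_ell2.rep_eq inner_add_left)
  have sc: "inner (complex_of_real r * a) b = r * inner a b" for a b
    by (metis inner_scaleR_left scaleR_conv_of_real)
  show "inner (r *\<^sub>R x) y = r * inner x y"
    unfolding inner_ell2_def
    by (simp add: scaleR_ell2.rep_eq sc infsum_cmult_right')
  have sq: "inner x x = (\<Sum>\<^sub>\<infinity>i. (cmod (ell2_apply x i))\<^sup>2)"
    by (simp add: inner_ell2_def power2_norm_eq_inner)
  show "0 \<le> inner x x" unfolding sq by (rule infsum_nonneg) simp
  show "(inner x x = 0) = (x = 0)"
  proof
    assume "inner x x = 0"
    then have "(cmod (ell2_apply x i))\<^sup>2 = 0" for i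
      unfolding sq
      by (intro nonneg_infsum_le_0D[where A = UNIV]) (auto simp: ell2_square_summable)
    then show "x = 0"
      by (intro ell2_apply_inject[THEN iffD1] ext) (simp add: zero_ell2.rep_eq)
  next
    assume "x = 0"
    then have "ell2_apply x i = 0" for i by (simp add: zero_ell2.rep_eq)
    then show "inner x x = 0" unfolding sq by simp
  qed
  show "norm x = sqrt (inner x x)" by (simp add: sq norm_ell2_def)
qed

end

instantiation ell2 :: (type) complex_normed_vector
begin

lift_definition scaleC_ell2 :: "complex \<Rightarrow> 'a ell2 \<Rightarrow> 'a ell2" is "\<lambda>c f i. c * f i"
  by (rule square_summable_cmult)

instance
proof
  fix x y :: "'a ell2" and c d :: complex and r :: real
  show "c *\<^sub>C (x + y) = c *\<^sub>C x + c *\<^sub>C y" by transfer (simp add: ring_distribs)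
  show "(c + d) *\<^sub>C x = c *\<^sub>C x + d *\<^sub>C x" by transfer (simp add: ring_distribs)
  show "c *\<^sub>C (d *\<^sub>C x) = (c * d) *\<^sub>C x" by transfer (simp add: mult.assoc)
  show "r *\<^sub>R x = complex_of_real r *\<^sub>C x" by transfer simp
  show "norm (c *\<^sub>C x) = cmod c * norm x"
    by (simp add: norm_ell2_def scaleC_ell2.rep_eq norm_mult power_mult_distrib
        infsum_cmult_right' real_sqrt_mult)
qed

end

lemma norm_ell2_squared: "(norm x)\<^sup>2 = (\<Sum>\<^sub>\<infinity>i. (cmod (ell2_apply x i))\<^sup>2)"
  by (simp add: norm_ell2_def infsum_nonneg)

lemma ell2_sum_le_norm: "finite F \<Longrightarrow> (\<Sum>i\<in>F. (cmod (ell2_apply x i))\<^sup>2) \<le> (norm x)\<^sup>2"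
  unfolding norm_ell2_squared by (rule finite_sum_le_infsum) (auto simp: ell2_square_summable)

lemma ell2_apply_le_norm: "cmod (ell2_apply x i) \<le> norm x"
  by (rule power2_le_imp_le) (use ell2_sum_le_norm[of "{i}" x] in auto)

lemma square_summable_bound:
  fixes f :: "'a \<Rightarrow> complex"
  assumes "\<And>F. finite F \<Longrightarrow> (\<Sum>i\<in>F. (cmod (f i))\<^sup>2) \<le> B"
  shows "(\<lambda>i. (cmod (f i))\<^sup>2) summable_on UNIV"
  by (rule nonneg_bdd_above_summable_on) (use assms in \<open>auto intro!: bdd_aboveI[of _ B]\<close>)

lemma norm_ell2_bound:
  assumes "\<And>F. finite F \<Longrightarrow> (\<Sum>i\<in>F. (cmod (ell2_apply x i))\<^sup>2) \<le> B\<^sup>2" "0 \<le> B"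
  shows "norm x \<le> B"
proof -
  have "(norm x)\<^sup>2 \<le> B\<^sup>2"
    unfolding norm_ell2_squared
    by (rule infsum_le_finite_sums) (use assms in \<open>auto simp: ell2_square_summable\<close>)
  then show ?thesis using assms(2) by (rule power2_le_imp_le)
qed

instance ell2 :: (type) banach
proof
  fix X :: "nat \<Rightarrow> 'a ell2" assume C: "Cauchy X"
  have "Cauchy (\<lambda>n. ell2_apply (X n) i)" for i
    unfolding Cauchy_def dist_norm
  proof (intro allI impI)
    fix e :: real assume "0 < e"
    then obtain M where "\<forall>m\<ge>M. \<forall>n\<ge>M. norm (X m - X n) < e"
      using C unfolding Cauchy_def dist_norm by blast
    then show "\<exists>M. \<forall>m\<ge>M. \<forall>n\<ge>M. cmod (ell2_apply (X m) i - ell2_apply (X n) i) < e"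
      by (metis ell2_apply_le_norm minus_ell2.rep_eq le_less_trans)
  qed
  then have "\<exists>l. (\<lambda>n. ell2_apply (X n) i) \<longlonglongrightarrow> l" for i
    using Cauchy_convergent convergent_def by blast
  then obtain g where g: "\<And>i. (\<lambda>n. ell2_apply (X n) i) \<longlonglongrightarrow> g i" by metis
  have bound: "\<exists>M. \<forall>n\<ge>M. \<forall>F. finite F \<longrightarrow> (\<Sum>i\<in>F. (cmod (ell2_apply (X n) i - g i))\<^sup>2) \<le> e\<^sup>2"
    if e: "0 < e" for e
  proof -
    obtain M where M: "\<forall>m\<ge>M. \<forall>n\<ge>M. norm (X m - X n) < e"
      using C e unfolding Cauchy_def dist_norm by blast
    have "(\<Sum>i\<in>F. (cmod (ell2_apply (X n) i - g i))\<^sup>2) \<le> e\<^sup>2" if "n \<ge> M" "finite F" for n F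
    proof (rule LIMSEQ_le_const2)
      show "(\<lambda>m. \<Sum>i\<in>F. (cmod (ell2_apply (X n) i - ell2_apply (X m) i))\<^sup>2)
          \<longlonglongrightarrow> (\<Sum>i\<in>F. (cmod (ell2_apply (X n) i - g i))\<^sup>2)"
        by (intro tendsto_intros g)
      have "(\<Sum>i\<in>F. (cmod (ell2_apply (X n) i - ell2_apply (X m) i))\<^sup>2) \<le> e\<^sup>2" if "m \<ge> M" for m
      proof -
        have "(\<Sum>i\<in>F. (cmod (ell2_apply (X n) i - ell2_apply (X m) i))\<^sup>2) \<le> (norm (X n - X m))\<^sup>2"
          using ell2_sum_le_norm[OF \<open>finite F\<close>, of "X n - X m"] by (simp add: minus_ell2.rep_eq)
        also have "\<dots> \<le> e\<^sup>2"
          using M \<open>n \<ge> M\<close> \<open>m \<ge> M\<close> by (intro power_mono) (auto intro: less_imp_le)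
        finally show ?thesis .
      qed
      then show "\<exists>N. \<forall>m\<ge>N. (\<Sum>i\<in>F. (cmod (ell2_apply (X n) i - ell2_apply (X m) i))\<^sup>2) \<le> e\<^sup>2"
        by blast
    qed
    then show ?thesis by blast
  qed
  obtain M where M: "\<And>F. finite F \<Longrightarrow> (\<Sum>i\<in>F. (cmod (ell2_apply (X M) i - g i))\<^sup>2) \<le> 1\<^sup>2"
    using bound[of 1] by auto
  have "(\<lambda>i. (cmod (ell2_apply (X M) i - g i))\<^sup>2) summable_on UNIV"
    using M by (rule square_summable_bound)
  then have "(\<lambda>i. (cmod (g i - ell2_apply (X M) i))\<^sup>2) summable_on UNIV"
    by (simp add: norm_minus_commute)
  from square_summable_add[OF this ell2_square_summable[of "X M"]]
  have "(\<lambda>i. (cmod (g i))\<^sup>2) summable_on UNIV" by simp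
  then have app: "ell2_apply (Abs_ell2 g) = g" by (simp add: Abs_ell2_inverse)
  have "X \<longlonglongrightarrow> Abs_ell2 g"
    unfolding lim_sequentially dist_norm
  proof (intro allI impI)
    fix e :: real assume e: "0 < e"
    then obtain M where M: "\<forall>n\<ge>M. \<forall>F. finite F \<longrightarrow>
        (\<Sum>i\<in>F. (cmod (ell2_apply (X n) i - g i))\<^sup>2) \<le> (e/2)\<^sup>2"
      using bound[of "e/2"] by auto
    have "norm (X n - Abs_ell2 g) < e" if "n \<ge> M" for n
    proof -
      have "norm (X n - Abs_ell2 g) \<le> e/2"
        by (rule norm_ell2_bound) (use M that e in \<open>auto simp: minus_ell2.rep_eq app\<close>)
      then show ?thesis using e by simp
    qed
    then show "\<exists>M. \<forall>n\<ge>M. norm (X n - Abs_ell2 g) < e" by blast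
  qed
  then show "convergent X" by (auto simp: convergent_def)
qed

definition cinner :: "'a ell2 \<Rightarrow> 'a ell2 \<Rightarrow> complex"
  where "cinner x y = (\<Sum>\<^sub>\<infinity>i. cnj (ell2_apply x i) * ell2_apply y i)"

lift_definition ket :: "'a \<Rightarrow> 'a ell2" is "\<lambda>i j. if j = i then 1 else 0"
proof -
  fix i :: 'a
  show "(\<lambda>j. (cmod (if j = i then 1 else 0))\<^sup>2) summable_on UNIV"
  proof (rule square_summable_bound)
    fix F :: "'a set" assume "finite F"
    moreover have "(cmod (if j = i then 1 else 0))\<^sup>2 = (if j = i then 1 else 0 :: real)" for j
      by simp
    ultimately show "(\<Sum>j\<in>F. (cmod (if j = i then 1 else 0))\<^sup>2) \<le> 1" by simp
  qed
qed

lemma cinner_add_right: "cinner x (y + z) = cinner x y + cinner x z"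
  unfolding cinner_def
  by (subst infsum_add[symmetric])
     (auto simp: ell2_cinner_summable plus_ell2.rep_eq ring_distribs)

lemma cinner_scaleC_right: "cinner x (c *\<^sub>C y) = c * cinner x y"
  unfolding cinner_def
  by (subst infsum_cmult_right'[symmetric]) (simp add: scaleC_ell2.rep_eq ac_simps)

lemma cinner_commute: "cinner y x = cnj (cinner x y)"
  unfolding cinner_def by (subst infsum_cnj[symmetric]) (simp add: mult.commute)

lemma cinner_add_left: "cinner (x + y) z = cinner x z + cinner y z"
  by (metis cinner_add_right cinner_commute complex_cnj_add)

lemma cinner_scaleC_left: "cinner (c *\<^sub>C x) y = cnj c * cinner x y"
  by (metis cinner_commute cinner_scaleC_right complex_cnj_mult)

lemma Re_cinner: "Re (cinner x y) = inner x y"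
  unfolding cinner_def inner_ell2_def
  by (subst infsum_Re[symmetric]) (auto simp: ell2_cinner_summable inner_complex_def)

lemma cinner_self: "cinner x x = complex_of_real ((norm x)\<^sup>2)"
proof (rule complex_eqI)
  show "Re (cinner x x) = Re (complex_of_real ((norm x)\<^sup>2))"
    by (simp only: Re_cinner power2_norm_eq_inner Re_complex_of_real)
  show "Im (cinner x x) = Im (complex_of_real ((norm x)\<^sup>2))"
    using arg_cong[OF cinner_commute[of x x], of Im] by simp
qed

lemma cmod_cinner_le: "cmod (cinner x y) \<le> norm x * norm y"
proof (cases "cinner x y = 0")
  case False
  define u where "u = cnj (sgn (cinner x y))"
  have u: "cmod u = 1" using False by (simp add: u_def norm_sgn)
  have "cinner x (u *\<^sub>C y) = complex_of_real (cmod (cinner x y))"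
  proof -
    have "cnj (cinner x y) * cinner x y = complex_of_real ((cmod (cinner x y))\<^sup>2)"
      by (simp only: complex_norm_square mult.commute)
    then show ?thesis
      using False by (simp add: cinner_scaleC_right u_def sgn_eq power2_eq_square)
  qed
  then have "cmod (cinner x y) = inner x (u *\<^sub>C y)"
    by (metis Re_cinner Re_complex_of_real)
  also have "\<dots> \<le> norm x * norm (u *\<^sub>C y)" by (rule norm_cauchy_schwarz)
  finally show ?thesis by (simp add: norm_scaleC u)
qed simp

lemma bounded_linear_cinner_right: "bounded_linear (cinner x)"
proof (rule bounded_linear_intro[of _ "norm x"])
  show "cinner x (y + z) = cinner x y + cinner x z" for y z by (rule cinner_add_right)
  show "cinner x (r *\<^sub>R y) = r *\<^sub>R cinner x y" for r y
    by (simp add: scaleR_scaleC cinner_scaleC_right scaleR_conv_of_real)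
  show "norm (cinner x y) \<le> norm y * norm x" for y
    using cmod_cinner_le[of x y] by (simp add: mult.commute)
qed

lemma cinner_ket_left: "cinner (ket i) x = ell2_apply x i"
proof -
  have "cinner (ket i) x = (\<Sum>\<^sub>\<infinity>j\<in>{i}. cnj (ell2_apply (ket i) j) * ell2_apply x j)"
    unfolding cinner_def by (rule infsum_cong_neutral) (auto simp: ket.rep_eq)
  then show ?thesis by (simp add: ket.rep_eq)
qed

lemma ell2_eqI: "(\<And>i. ell2_apply x i = ell2_apply y i) \<Longrightarrow> x = y"
  by (metis ell2_apply_inject ext)

lemma cinner_eqI: "(\<And>z. cinner z x = cinner z y) \<Longrightarrow> x = y"
  by (rule ell2_eqI) (metis cinner_ket_left)

lemma ell2_apply_sum: "ell2_apply (sum f F) i = (\<Sum>j\<in>F. ell2_apply (f j) i)"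
  by (induction F rule: infinite_finite_induct) (auto simp: zero_ell2.rep_eq plus_ell2.rep_eq)

lemma ell2_apply_finite_combination:
  "finite F \<Longrightarrow> ell2_apply (\<Sum>j\<in>F. c j *\<^sub>C ket j) i = (if i \<in> F then c i else 0)"
  by (simp add: ell2_apply_sum scaleC_ell2.rep_eq ket.rep_eq if_distrib cong: if_cong)

lemma has_sum_ket: "((\<lambda>i. ell2_apply x i *\<^sub>C ket i) has_sum x) UNIV"
  unfolding has_sum_def tendsto_iff
proof (intro allI impI)
  fix e :: real assume e: "0 < e"
  have "((\<lambda>i. (cmod (ell2_apply x i))\<^sup>2) has_sum (norm x)\<^sup>2) UNIV"
    unfolding norm_ell2_squared using ell2_square_summable by (rule has_sum_infsum)
  then have "\<forall>\<^sub>F F in finite_subsets_at_top UNIV.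
      dist (\<Sum>i\<in>F. (cmod (ell2_apply x i))\<^sup>2) ((norm x)\<^sup>2) < (e/2)\<^sup>2"
    unfolding has_sum_def tendsto_iff using e by simp
  moreover have "\<forall>\<^sub>F F in finite_subsets_at_top (UNIV :: 'a set). finite F"
    by (rule eventually_finite_subsets_at_top_weakI) 
  ultimately show "\<forall>\<^sub>F F in finite_subsets_at_top UNIV.
      dist (\<Sum>i\<in>F. ell2_apply x i *\<^sub>C ket i) x < e"
  proof eventually_elim
    case (elim F)
    have "norm (x - (\<Sum>i\<in>F. ell2_apply x i *\<^sub>C ket i)) \<le> e/2"
    proof (rule norm_ell2_bound)
      fix G :: "'a set" assume G: "finite G"
      have "(\<Sum>i\<in>G. (cmod (ell2_apply (x - (\<Sum>i\<in>F. ell2_apply x i *\<^sub>C ket i)) i))\<^sup>2)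
          = (\<Sum>i\<in>G - F. (cmod (ell2_apply x i))\<^sup>2)"
        using G elim(2)
        by (intro sum.mono_neutral_cong_right)
           (auto simp: minus_ell2.rep_eq ell2_apply_finite_combination)
      also have "\<dots> = (\<Sum>i\<in>G \<union> F. (cmod (ell2_apply x i))\<^sup>2) - (\<Sum>i\<in>F. (cmod (ell2_apply x i))\<^sup>2)"
        using G elim(2) by (subst sum_diff[symmetric]) (auto intro!: sum.cong)
      also have "\<dots> \<le> (norm x)\<^sup>2 - (\<Sum>i\<in>F. (cmod (ell2_apply x i))\<^sup>2)"
        using ell2_sum_le_norm[of "G \<union> F" x] G elim(2) by simp
      also have "\<dots> \<le> (e/2)\<^sup>2"
        using elim(1) by (simp add: dist_real_def abs_less_iff)
      finally show "(\<Sum>i\<in>G. (cmod (ell2_apply (x - (\<Sum>i\<in>F. ell2_apply x i *\<^sub>C ket i)) i))\<^sup>2)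
          \<le> (e/2)\<^sup>2" .
    qed (use e in simp)
    then show ?case using e by (simp add: dist_norm norm_minus_commute)
  qed
qed

lemma norm_ket [simp]: "norm (ket i) = 1"
proof -
  have "complex_of_real ((norm (ket i))\<^sup>2) = 1"
    unfolding cinner_self[symmetric] cinner_ket_left by (simp add: ket.rep_eq)
  then have "(norm (ket i))\<^sup>2 = 1" using of_real_eq_1_iff by blast
  then show ?thesis using norm_ge_zero[of "ket i"] power2_eq_1_iff[of "norm (ket i)"] by linarith
qed

section \<open>Bounded complex-linear operators\<close>

lifting_forget ell2.lifting

typedef 'a l2op = "{T :: 'a ell2 \<Rightarrow>\<^sub>L 'a ell2. \<forall>c x. T (c *\<^sub>C x) = c *\<^sub>C T x}"
  morphisms l2op_blinfun Abs_l2op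
  by (rule exI[of _ 0]) (simp, metis ell2_apply_inject mult_zero_right scaleC_ell2.rep_eq zero_ell2.rep_eq ext)

setup_lifting type_definition_l2op

lemma scaleC_zero_right [simp]: "c *\<^sub>C (0 :: 'a :: complex_normed_vector) = 0"
  using norm_scaleC[of c "0 :: 'a"] by simp

lemma scaleC_minus_right: "c *\<^sub>C (- x) = - (c *\<^sub>C (x :: 'a :: complex_normed_vector))"
  by (metis add.right_inverse add_eq_0_iff scaleC_add_right scaleC_zero_right)

lemma scaleC_diff_right: "c *\<^sub>C (x - y) = c *\<^sub>C x - c *\<^sub>C (y :: 'a :: complex_normed_vector)"
  by (metis scaleC_add_right scaleC_minus_right uminus_add_conv_diff add.commute)

lemma scaleC_scaleR_commute: "c *\<^sub>C (r *\<^sub>R x) = r *\<^sub>R (c *\<^sub>C (x :: 'a :: complex_normed_vector))"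
  by (simp add: scaleR_scaleC scaleC_scaleC mult.commute)

lemma scaleC_one [simp]: "1 *\<^sub>C x = (x :: 'a :: complex_normed_vector)"
  using scaleR_scaleC[of 1 x] by simp

instantiation l2op :: (type) real_vector
begin

lift_definition zero_l2op :: "'a l2op" is 0 by simp
lift_definition plus_l2op :: "'a l2op \<Rightarrow> 'a l2op \<Rightarrow> 'a l2op" is "(+)"
  by (simp add: blinfun.add_left scaleC_add_right)
lift_definition minus_l2op :: "'a l2op \<Rightarrow> 'a l2op \<Rightarrow> 'a l2op" is "(-)"
  by (simp add: blinfun.diff_left scaleC_diff_right)
lift_definition uminus_l2op :: "'a l2op \<Rightarrow> 'a l2op" is uminus
  by (simp add: blinfun.minus_left scaleC_minus_right)
lift_definition scaleR_l2op :: "real \<Rightarrow> 'a l2op \<Rightarrow> 'a l2op" is scaleR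
  by (simp add: blinfun.scaleR_left scaleC_scaleR_commute)

instance
proof
  fix x y z :: "'a l2op" and r s :: real
  show "x + y + z = x + (y + z)" by transfer (rule add.assoc)
  show "x + y = y + x" by transfer (rule add.commute)
  show "0 + x = x" by transfer simp
  show "- x + x = 0" by transfer simp
  show "x - y = x + - y" by transfer simp
  show "r *\<^sub>R (x + y) = r *\<^sub>R x + r *\<^sub>R y" by transfer (rule scaleR_add_right)
  show "(r + s) *\<^sub>R x = r *\<^sub>R x + s *\<^sub>R x" by transfer (rule scaleR_add_left)
  show "r *\<^sub>R s *\<^sub>R x = (r * s) *\<^sub>R x" by transfer simp
  show "1 *\<^sub>R x = x" by transfer simp
qed

end

lift_definition l2op_apply :: "'a l2op \<Rightarrow> 'a ell2 \<Rightarrow> 'a ell2" is blinfun_apply .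

lemma bounded_linear_scaleC: "bounded_linear (\<lambda>x :: 'a :: complex_normed_vector. c *\<^sub>C x)"
  by (rule bounded_linear_intro[of _ "cmod c"])
     (auto simp: scaleC_add_right scaleC_scaleR_commute norm_scaleC mult.commute)

instantiation l2op :: (type) complex_normed_vector
begin

lift_definition norm_l2op :: "'a l2op \<Rightarrow> real" is norm .
definition sgn_l2op :: "'a l2op \<Rightarrow> 'a l2op" where "sgn_l2op x = inverse (norm x) *\<^sub>R x"
definition dist_l2op :: "'a l2op \<Rightarrow> 'a l2op \<Rightarrow> real" where "dist_l2op x y = norm (x - y)"
definition uniformity_l2op :: "('a l2op \<times> 'a l2op) filter"
  where "uniformity_l2op = (INF e\<in>{0<..}. principal {(x, y). dist x y < e})"
definition open_l2op :: "'a l2op set \<Rightarrow> bool"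
  where "open_l2op U = (\<forall>x\<in>U. eventually (\<lambda>(x', y). x' = x \<longrightarrow> y \<in> U) uniformity)"
lift_definition scaleC_l2op :: "complex \<Rightarrow> 'a l2op \<Rightarrow> 'a l2op"
  is "\<lambda>c (T :: 'a ell2 \<Rightarrow>\<^sub>L 'a ell2). Blinfun (\<lambda>x. c *\<^sub>C T x)"
  by (simp add: bounded_linear_Blinfun_apply scaleC_scaleC mult.commute
      bounded_linear_compose[OF bounded_linear_scaleC blinfun.bounded_linear_right])

lemma scaleC_l2op_apply: "l2op_apply (c *\<^sub>C T) x = c *\<^sub>C l2op_apply T x"
  by transfer
     (simp add: bounded_linear_Blinfun_apply
        bounded_linear_compose[OF bounded_linear_scaleC blinfun.bounded_linear_right])

lemma l2op_eqI: "(\<And>x. l2op_apply S x = l2op_apply T x) \<Longrightarrow> S = T"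
  by transfer (rule blinfun_eqI)

lemma l2op_apply_add: "l2op_apply (S + T) x = l2op_apply S x + l2op_apply T x"
  by transfer (rule blinfun.add_left)

lemma l2op_apply_scaleR: "l2op_apply (r *\<^sub>R T) x = r *\<^sub>R l2op_apply T x"
  by transfer (rule blinfun.scaleR_left)

lemma norm_l2op_apply: "norm (l2op_apply T x) \<le> norm T * norm x"
  by transfer (rule norm_blinfun)

lemma norm_l2op_ge_zero: "0 \<le> norm (T :: 'a l2op)"
  by transfer simp

lemma norm_l2op_bound:
  "0 \<le> b \<Longrightarrow> (\<And>x. norm (l2op_apply T x) \<le> b * norm x) \<Longrightarrow> norm T \<le> b"
  by transfer (rule norm_blinfun_bound)

instance
proof
  fix x y z :: "'a l2op" and r s :: real and c d :: complex
  show "sgn x = x /\<^sub>R norm x" by (rule sgn_l2op_def)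
  show "dist x y = norm (x - y)" by (rule dist_l2op_def)
  show "uniformity = (INF e\<in>{0<..}. principal {(x::'a l2op, y). dist x y < e})"
    by (rule uniformity_l2op_def)
  show "open U = (\<forall>x\<in>U. eventually (\<lambda>(x', y). x' = x \<longrightarrow> y \<in> U) uniformity)"
    for U :: "'a l2op set" by (rule open_l2op_def)
  show "(norm x = 0) = (x = 0)" by transfer simp
  show "norm (x + y) \<le> norm x + norm y" by transfer (rule norm_triangle_ineq)
  show "norm (r *\<^sub>R x) = \<bar>r\<bar> * norm x" by transfer simp
  show "c *\<^sub>C (x + y) = c *\<^sub>C x + c *\<^sub>C y"
    by (rule l2op_eqI) (simp add: scaleC_l2op_apply l2op_apply_add scaleC_add_right)
  show "(c + d) *\<^sub>C x = c *\<^sub>C x + d *\<^sub>C x"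
    by (rule l2op_eqI) (simp add: scaleC_l2op_apply l2op_apply_add scaleC_add_left)
  show sc: "c *\<^sub>C (d *\<^sub>C x) = (c * d) *\<^sub>C x" for c d and x :: "'a l2op"
    by (rule l2op_eqI) (simp add: scaleC_l2op_apply scaleC_scaleC)
  show "r *\<^sub>R x = complex_of_real r *\<^sub>C x"
    by (rule l2op_eqI) (simp add: scaleC_l2op_apply l2op_apply_scaleR scaleR_scaleC)
  have le: "norm (c *\<^sub>C x) \<le> cmod c * norm x" for c and x :: "'a l2op"
  proof (rule norm_l2op_bound)
    show "norm (l2op_apply (c *\<^sub>C x) v) \<le> cmod c * norm x * norm v" for v
      using mult_left_mono[OF norm_l2op_apply[of x v] norm_ge_zero[of c]]
      by (simp add: scaleC_l2op_apply norm_scaleC mult.assoc)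
  qed (simp add: norm_l2op_ge_zero)
  have one: "1 *\<^sub>C x = x" for x :: "'a l2op"
    by (rule l2op_eqI) (simp add: scaleC_l2op_apply)
  show "norm (c *\<^sub>C x) = cmod c * norm x"
  proof (cases "c = 0")
    case True
    then show ?thesis using le[of 0 x] norm_l2op_ge_zero[of "0 *\<^sub>C x"] by simp
  next
    case False
    have "cmod c * norm x = cmod c * norm (inverse c *\<^sub>C (c *\<^sub>C x))"
      using False by (simp add: sc one)
    also have "\<dots> \<le> cmod c * (cmod (inverse c) * norm (c *\<^sub>C x))"
      by (intro mult_left_mono le) simp
    also have "\<dots> = norm (c *\<^sub>C x)"
      using False by (simp add: norm_inverse)
    finally show ?thesis using le[of c x] by simp
  qed
qed

end

lemma l2op_apply_scaleC: "l2op_apply T (c *\<^sub>C x) = c *\<^sub>C l2op_apply T x"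
  by transfer simp

lemma bounded_linear_l2op_apply: "bounded_linear (l2op_apply T)"
  by transfer (rule blinfun.bounded_linear_right)

lemma l2op_exists:
  fixes f :: "'a ell2 \<Rightarrow> 'a ell2"
  assumes "bounded_linear f" "\<And>c x. f (c *\<^sub>C x) = c *\<^sub>C f x"
  shows "\<exists>T. l2op_apply T = f"
proof
  have B: "blinfun_apply (Blinfun f) = f" by (rule bounded_linear_Blinfun_apply[OF assms(1)])
  then have "Blinfun f \<in> {T :: 'a ell2 \<Rightarrow>\<^sub>L 'a ell2. \<forall>c x. T (c *\<^sub>C x) = c *\<^sub>C T x}" using assms(2) by simp
  then show "l2op_apply (Abs_l2op (Blinfun f)) = f"
    by (simp add: l2op_apply.rep_eq Abs_l2op_inverse B)
qed

lemma l2op_eq_ketI: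
  assumes "\<And>i. l2op_apply S (ket i) = l2op_apply T (ket i)"
  shows "S = (T :: 'a l2op)"
proof (rule l2op_eqI)
  fix x :: "'a ell2"
  have "((\<lambda>i. ell2_apply x i *\<^sub>C l2op_apply U (ket i)) has_sum l2op_apply U x) UNIV" for U :: "'a l2op"
    using has_sum_bounded_linear[OF bounded_linear_l2op_apply has_sum_ket[of x], of U]
    by (simp add: l2op_apply_scaleC)
  from this[of S] this[of T] show "l2op_apply S x = l2op_apply T x"
    unfolding assms by (rule has_sum_unique)
qed

lemma l2op_adjoint_ex1:
  "\<exists>!S. \<forall>x y. cinner (l2op_apply S x) y = cinner x (l2op_apply T y)"
proof -
  define g where "g x j = cinner (l2op_apply T (ket j)) x" for x j
  have g_bound: "(\<Sum>j\<in>F. (cmod (g x j))\<^sup>2) \<le> (norm T * norm x)\<^sup>2" if F: "finite F" for F x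
  proof -
    define s where "s = (\<Sum>j\<in>F. (cmod (g x j))\<^sup>2)"
    define v where "v = (\<Sum>j\<in>F. g x j *\<^sub>C ket j)"
    have s0: "0 \<le> s" by (simp add: s_def sum_nonneg)
    have ci: "cinner (\<Sum>j\<in>F. h j) y = (\<Sum>j\<in>F. cinner (h j) y)" for h y
    proof -
      have "cinner 0 y = 0" by (simp add: cinner_def zero_ell2.rep_eq)
      from F show ?thesis
        by (induction F rule: finite_induct) (auto simp: \<open>cinner 0 y = 0\<close> cinner_add_left)
    qed
    have sq: "cnj z * z = complex_of_real ((cmod z)\<^sup>2)" for z
      by (simp only: complex_norm_square mult.commute)
    have "cinner (l2op_apply T v) x = complex_of_real s"
      by (simp add: v_def linear_sum[OF bounded_linear.linear[OF bounded_linear_l2op_apply]] l2op_apply_scaleC ci cinner_scaleC_left g_def[symmetric] sq s_def)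
    then have 1: "s \<le> norm (l2op_apply T v) * norm x"
      using cmod_cinner_le[of "l2op_apply T v" x] s0 by simp
    have "cinner v v = complex_of_real s"
      by (simp add: v_def ci cinner_scaleC_left cinner_ket_left
          ell2_apply_finite_combination[OF F] sq s_def)
    then have 2: "(norm v)\<^sup>2 = s"
      unfolding cinner_self by (simp only: of_real_eq_iff)
    have "(norm v)\<^sup>2 \<le> (norm T * norm v) * norm x"
      using 1 mult_right_mono[OF norm_l2op_apply[of T v] norm_ge_zero[of x]] 2 by linarith
    then have "norm v \<le> norm T * norm x"
      by (cases "norm v = 0") (auto simp: power2_eq_square ac_simps)
    then show ?thesis using 2 unfolding s_def[symmetric] by (metis norm_ge_zero power_mono)
  qed
  have g_sum: "(\<lambda>j. (cmod (g x j))\<^sup>2) summable_on UNIV" for x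
    by (rule square_summable_bound[OF g_bound])
  define S where "S x = Abs_ell2 (g x)" for x
  have S_apply: "ell2_apply (S x) = g x" for x
    using g_sum[of x] by (simp add: S_def Abs_ell2_inverse)
  have S_scaleC: "S (c *\<^sub>C x) = c *\<^sub>C S x" for c x
    by (rule ell2_eqI) (simp add: S_apply scaleC_ell2.rep_eq g_def cinner_scaleC_right)
  have "bounded_linear S"
  proof (rule bounded_linear_intro[of _ "norm T"])
    show "S (x + y) = S x + S y" for x y
      by (rule ell2_eqI) (simp add: S_apply plus_ell2.rep_eq g_def cinner_add_right)
    show "S (r *\<^sub>R x) = r *\<^sub>R S x" for r x
      by (simp add: scaleR_scaleC S_scaleC)
    show "norm (S x) \<le> norm x * norm T" for x
      by (rule norm_ell2_bound) (use g_bound[of _ x] in \<open>auto simp: S_apply mult.commute\<close>)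
  qed
  then obtain A where A: "l2op_apply A = S" using l2op_exists S_scaleC by blast
  have "cinner (l2op_apply A x) y = cinner x (l2op_apply T y)" for x y
  proof -
    have "((\<lambda>i. cinner (S x) (ell2_apply y i *\<^sub>C ket i)) has_sum cinner (S x) y) UNIV"
      by (rule has_sum_bounded_linear[OF bounded_linear_cinner_right has_sum_ket])
    moreover have "((\<lambda>i. cinner x (l2op_apply T (ell2_apply y i *\<^sub>C ket i)))
        has_sum cinner x (l2op_apply T y)) UNIV"
      by (intro has_sum_bounded_linear[OF bounded_linear_cinner_right]
          has_sum_bounded_linear[OF bounded_linear_l2op_apply] has_sum_ket)
    moreover have "cinner (S x) (ket i) = cinner x (l2op_apply T (ket i))" for i
      by (metis S_apply cinner_commute cinner_ket_left g_def)
    ultimately show ?thesis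
      unfolding A l2op_apply_scaleC cinner_scaleC_right by (metis (no_types, lifting) has_sum_cong has_sum_unique)
  qed
  moreover have "B = A"
    if "\<forall>x y. cinner (l2op_apply B x) y = cinner x (l2op_apply T y)" for B
    using calculation that by (intro l2op_eqI cinner_eqI) (metis cinner_commute)
  ultimately show ?thesis by blast
qed

instantiation l2op :: (type) cstar_algebra
begin

lift_definition times_l2op :: "'a l2op \<Rightarrow> 'a l2op \<Rightarrow> 'a l2op" is "(o\<^sub>L)" by simp

definition star_l2op :: "'a l2op \<Rightarrow> 'a l2op" where
  "star_l2op T = (THE S. \<forall>x y. cinner (l2op_apply S x) y = cinner x (l2op_apply T y))"

lemma l2op_apply_mult: "l2op_apply (S * T) x = l2op_apply S (l2op_apply T x)"
  by transfer simp

lemma cinner_star_left: "cinner (l2op_apply (star T) x) y = cinner x (l2op_apply T y)"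
  using theI'[OF l2op_adjoint_ex1[of T]] unfolding star_l2op_def by blast

lemma cinner_star_right: "cinner x (l2op_apply (star T) y) = cinner (l2op_apply T x) y"
  by (metis cinner_star_left cinner_commute)

lemma star_l2op_eqI:
  "(\<And>x y. cinner (l2op_apply S x) y = cinner x (l2op_apply T y)) \<Longrightarrow> star T = S"
  unfolding star_l2op_def by (rule the1_equality[OF l2op_adjoint_ex1]) blast

instance
proof
  fix x y z :: "'a l2op" and r :: real and c :: complex
  show "x * y * z = x * (y * z)" by (rule l2op_eqI) (simp add: l2op_apply_mult)
  show "(x + y) * z = x * z + y * z" by (rule l2op_eqI) (simp add: l2op_apply_mult l2op_apply_add)
  have add: "l2op_apply x (v + w) = l2op_apply x v + l2op_apply x w" for v w
    by (rule linear_add[OF bounded_linear.linear[OF bounded_linear_l2op_apply]])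
  show "x * (y + z) = x * y + x * z"
    by (rule l2op_eqI) (simp add: l2op_apply_mult l2op_apply_add add)
  show "(c *\<^sub>C x) * y = c *\<^sub>C (x * y)" for c
    by (rule l2op_eqI) (simp add: l2op_apply_mult scaleC_l2op_apply)
  show cr: "x * (c *\<^sub>C y) = c *\<^sub>C (x * y)" for c
    by (rule l2op_eqI) (simp add: l2op_apply_mult scaleC_l2op_apply l2op_apply_scaleC)
  show "r *\<^sub>R x * y = r *\<^sub>R (x * y)"
    by (rule l2op_eqI) (simp add: l2op_apply_mult l2op_apply_scaleR)
  show "x * r *\<^sub>R y = r *\<^sub>R (x * y)" by (simp add: scaleR_scaleC cr)
  show mult_le: "norm (x * y) \<le> norm x * norm y" for x y :: "'a l2op"
    by transfer (rule norm_blinfun_compose)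
  show "star (x + y) = star x + star y"
    by (rule star_l2op_eqI)
       (simp add: l2op_apply_add cinner_add_left cinner_add_right cinner_star_left)
  show "star (c *\<^sub>C x) = cnj c *\<^sub>C star x"
    by (rule star_l2op_eqI)
       (simp add: scaleC_l2op_apply cinner_scaleC_left cinner_scaleC_right cinner_star_left)
  show "star (x * y) = star y * star x"
    by (rule star_l2op_eqI) (simp add: l2op_apply_mult cinner_star_left)
  show "star (star x) = x"
    by (rule star_l2op_eqI) (simp add: cinner_star_right)
  have upper: "(norm T)\<^sup>2 \<le> norm (star T * T)" for T :: "'a l2op"
  proof -
    have "norm T \<le> sqrt (norm (star T * T))"
    proof (rule norm_l2op_bound)
      fix v
      have "complex_of_real ((norm (l2op_apply T v))\<^sup>2) = cinner v (l2op_apply (star T * T) v)"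
        by (simp only: cinner_self[symmetric] l2op_apply_mult cinner_star_right)
      then have "(norm (l2op_apply T v))\<^sup>2 = cmod (cinner v (l2op_apply (star T * T) v))"
        by (metis norm_of_real abs_power2)
      also have "\<dots> \<le> norm v * norm (l2op_apply (star T * T) v)" by (rule cmod_cinner_le)
      also have "\<dots> \<le> norm v * (norm (star T * T) * norm v)"
        by (intro mult_left_mono norm_l2op_apply) simp
      also have "\<dots> = (sqrt (norm (star T * T)) * norm v)\<^sup>2"
        by (simp add: power_mult_distrib power2_eq_square)
      finally show "norm (l2op_apply T v) \<le> sqrt (norm (star T * T)) * norm v"
        by (rule power2_le_imp_le) simp
    qed simp
    then have "(norm T)\<^sup>2 \<le> (sqrt (norm (star T * T)))\<^sup>2" by (rule power_mono) simp
    then show ?thesis by simp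
  qed
  have star_le: "norm T \<le> norm (star T)" for T :: "'a l2op"
  proof -
    have "norm T * norm T \<le> norm (star T) * norm T"
      using upper[of T] mult_le[of "star T" T] by (simp add: power2_eq_square)
    then show ?thesis by (cases "norm T = 0") auto
  qed
  have "norm (star x) \<le> norm x"
    using star_le[of "star x"] \<open>star (star x) = x\<close> by simp
  then have "norm (star x * x) \<le> norm x * norm x"
    using mult_le[of "star x" x] mult_right_mono[of "norm (star x)" "norm x" "norm x"] by simp
  then show "norm (star x * x) = (norm x)\<^sup>2"
    using upper[of x] by (simp add: power2_eq_square)
next
  fix X :: "nat \<Rightarrow> 'a l2op" assume "Cauchy X"
  have d: "dist x y = dist (l2op_blinfun x) (l2op_blinfun y)" for x y :: "'a l2op"
    unfolding dist_norm by transfer simp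
  have "Cauchy (\<lambda>n. l2op_blinfun (X n))"
    using \<open>Cauchy X\<close> unfolding Cauchy_def d .
  then obtain L where L: "(\<lambda>n. l2op_blinfun (X n)) \<longlonglongrightarrow> L"
    using Cauchy_convergent convergent_def by blast
  have lim: "(\<lambda>n. l2op_blinfun (X n) x) \<longlonglongrightarrow> L x" for x
    by (intro tendsto_intros L)
  have "L (c *\<^sub>C x) = c *\<^sub>C L x" for c x
  proof (rule LIMSEQ_unique)
    show "(\<lambda>n. l2op_blinfun (X n) (c *\<^sub>C x)) \<longlonglongrightarrow> L (c *\<^sub>C x)" by (rule lim)
    have "(\<lambda>n. c *\<^sub>C l2op_blinfun (X n) x) \<longlonglongrightarrow> c *\<^sub>C L x"
      by (rule bounded_linear.tendsto[OF bounded_linear_scaleC lim])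
    then show "(\<lambda>n. l2op_blinfun (X n) (c *\<^sub>C x)) \<longlonglongrightarrow> c *\<^sub>C L x"
      using l2op_blinfun[where 'a = 'a] by simp
  qed
  then have "l2op_blinfun (Abs_l2op L) = L" by (simp add: Abs_l2op_inverse)
  then have "X \<longlonglongrightarrow> Abs_l2op L"
    using L unfolding lim_sequentially d by simp
  then show "convergent X" by (auto simp: convergent_def)
qed

end

section \<open>Tensor products of vectors and operators\<close>

text \<open>
  \<open>\<ell>\<^sup>2('a \<times> 'b)\<close> serves as the Hilbert space tensor product of \<open>\<ell>\<^sup>2('a)\<close> and \<open>\<ell>\<^sup>2('b)\<close>.
\<close>

definition tensor_ell2 :: "'a ell2 \<Rightarrow> 'b ell2 \<Rightarrow> ('a \<times> 'b) ell2" (infixr \<open>\<otimes>\<^sub>v\<close> 70)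
  where "x \<otimes>\<^sub>v y = Abs_ell2 (\<lambda>(i, j). ell2_apply x i * ell2_apply y j)"

definition tensor_op :: "'a l2op \<Rightarrow> 'b l2op \<Rightarrow> ('a \<times> 'b) l2op" (infixr \<open>\<otimes>\<^sub>o\<close> 70)
  where "S \<otimes>\<^sub>o T =
    (THE U. \<forall>x y. l2op_apply U (x \<otimes>\<^sub>v y) = l2op_apply S x \<otimes>\<^sub>v l2op_apply T y)"

lemma tensor_ell2_apply:
  "ell2_apply (x \<otimes>\<^sub>v y) (i, j) = ell2_apply x i * ell2_apply y j"
proof -
  let ?f = "\<lambda>(i, j). ell2_apply x i * ell2_apply y j"
  have "(\<lambda>p. (cmod (?f p))\<^sup>2) summable_on UNIV"
  proof (rule square_summable_bound)
    fix F :: "('a \<times> 'b) set" assume F: "finite F"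
    have "(\<Sum>p\<in>F. (cmod (?f p))\<^sup>2) \<le> (\<Sum>p\<in>fst ` F \<times> snd ` F. (cmod (?f p))\<^sup>2)"
      using F by (intro sum_mono2) (auto simp: image_iff, force+)
    also have "\<dots> = (\<Sum>i\<in>fst ` F. (cmod (ell2_apply x i))\<^sup>2) * (\<Sum>j\<in>snd ` F. (cmod (ell2_apply y j))\<^sup>2)"
      by (simp add: sum_product sum.cartesian_product norm_mult power_mult_distrib case_prod_unfold)
    also have "\<dots> \<le> (norm x)\<^sup>2 * (norm y)\<^sup>2"
      using F by (intro mult_mono ell2_sum_le_norm) (auto intro: sum_nonneg)
    finally show "(\<Sum>p\<in>F. (cmod (?f p))\<^sup>2) \<le> (norm x)\<^sup>2 * (norm y)\<^sup>2" .
  qed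
  then show ?thesis by (simp add: tensor_ell2_def Abs_ell2_inverse)
qed

lemma ket_pair: "ket (i, j) = ket i \<otimes>\<^sub>v ket j"
  by (rule ell2_eqI) (auto simp: tensor_ell2_apply ket.rep_eq split: if_splits)

lemma l2op_ampliation:
  fixes T :: "'b l2op"
  shows "\<exists>A :: ('a \<times> 'b) l2op. (\<forall>x y. l2op_apply A (x \<otimes>\<^sub>v y) = x \<otimes>\<^sub>v l2op_apply T y) \<and> norm A \<le> norm T"
proof -
  define row where "row f i = Abs_ell2 (\<lambda>j. ell2_apply f (i, j))" for f :: "('a \<times> 'b) ell2" and i
  have row_apply: "ell2_apply (row f i) j = ell2_apply f (i, j)" for f i j
  proof -
    have "(\<lambda>j. (cmod (ell2_apply f (i, j)))\<^sup>2) summable_on UNIV"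
    proof (rule square_summable_bound)
      fix F :: "'b set" assume "finite F"
      then show "(\<Sum>j\<in>F. (cmod (ell2_apply f (i, j)))\<^sup>2) \<le> (norm f)\<^sup>2"
        using ell2_sum_le_norm[of "Pair i ` F" f] by (simp add: sum.reindex inj_on_def)
    qed
    then show ?thesis by (simp add: row_def Abs_ell2_inverse)
  qed
  have rows_le: "(\<Sum>i\<in>F. (norm (row f i))\<^sup>2) \<le> (norm f)\<^sup>2" if "finite F" for f F
  proof -
    have s: "(\<lambda>p. (cmod (ell2_apply f p))\<^sup>2) summable_on (UNIV \<times> UNIV)"
      using ell2_square_summable[of f] by simp
    have r: "(norm (row f i))\<^sup>2 = (\<Sum>\<^sub>\<infinity>j. (cmod (ell2_apply f (i, j)))\<^sup>2)" for i
      by (simp add: norm_ell2_squared row_apply)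
    have "(\<lambda>i. (norm (row f i))\<^sup>2) summable_on UNIV"
      unfolding r using s by (intro summable_on_Sigma_banach) (simp add: case_prod_unfold)
    then have "(\<Sum>i\<in>F. (norm (row f i))\<^sup>2) \<le> (\<Sum>\<^sub>\<infinity>i. (norm (row f i))\<^sup>2)"
      using that by (intro finite_sum_le_infsum) auto
    also have "\<dots> = (norm f)\<^sup>2"
      unfolding norm_ell2_squared row_apply using infsum_Sigma_banach[OF s] by simp
    finally show ?thesis .
  qed
  define h where "h f p = ell2_apply (l2op_apply T (row f (fst p))) (snd p)" for f p
  have h_bound: "(\<Sum>p\<in>F. (cmod (h f p))\<^sup>2) \<le> (norm T * norm f)\<^sup>2" if F: "finite F" for f F
  proof -
    have "(\<Sum>p\<in>F. (cmod (h f p))\<^sup>2) \<le> (\<Sum>p\<in>fst ` F \<times> snd ` F. (cmod (h f p))\<^sup>2)"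
      using F by (intro sum_mono2) (auto simp: image_iff, force+)
    also have "\<dots> = (\<Sum>i\<in>fst ` F. \<Sum>j\<in>snd ` F. (cmod (ell2_apply (l2op_apply T (row f i)) j))\<^sup>2)"
      by (simp add: sum.cartesian_product h_def case_prod_unfold)
    also have "\<dots> \<le> (\<Sum>i\<in>fst ` F. (norm T)\<^sup>2 * (norm (row f i))\<^sup>2)"
    proof (rule sum_mono)
      fix i
      have "(\<Sum>j\<in>snd ` F. (cmod (ell2_apply (l2op_apply T (row f i)) j))\<^sup>2)
          \<le> (norm (l2op_apply T (row f i)))\<^sup>2"
        using F by (intro ell2_sum_le_norm) simp
      also have "\<dots> \<le> (norm T * norm (row f i))\<^sup>2"
        by (intro power_mono norm_l2op_apply) simp
      finally show "(\<Sum>j\<in>snd ` F. (cmod (ell2_apply (l2op_apply T (row f i)) j))\<^sup>2)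
          \<le> (norm T)\<^sup>2 * (norm (row f i))\<^sup>2"
        by (simp add: power_mult_distrib)
    qed
    also have "\<dots> \<le> (norm T)\<^sup>2 * (norm f)\<^sup>2"
      unfolding sum_distrib_left[symmetric] using F by (intro mult_left_mono rows_le) auto
    finally show ?thesis by (simp add: power_mult_distrib)
  qed
  define H where "H f = Abs_ell2 (h f)" for f
  have H_apply: "ell2_apply (H f) = h f" for f
    using square_summable_bound[OF h_bound, of f] by (simp add: H_def Abs_ell2_inverse)
  have row_add: "row (f + g) i = row f i + row g i" for f g i
    by (rule ell2_eqI) (simp add: row_apply plus_ell2.rep_eq)
  have row_scaleC: "row (c *\<^sub>C f) i = c *\<^sub>C row f i" for c f i
    by (rule ell2_eqI) (simp add: row_apply scaleC_ell2.rep_eq)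
  have T_add: "l2op_apply T (v + w) = l2op_apply T v + l2op_apply T w" for v w
    by (rule linear_add[OF bounded_linear.linear[OF bounded_linear_l2op_apply]])
  have H_norm: "norm (H f) \<le> norm T * norm f" for f
    by (rule norm_ell2_bound) (use h_bound[of _ f] in \<open>auto simp: H_apply\<close>)
  have H_scaleC: "H (c *\<^sub>C f) = c *\<^sub>C H f" for c f
    by (rule ell2_eqI) (simp add: H_apply h_def row_scaleC l2op_apply_scaleC scaleC_ell2.rep_eq)
  have "bounded_linear H"
  proof (rule bounded_linear_intro[of _ "norm T"])
    show "H (f + g) = H f + H g" for f g
      by (rule ell2_eqI) (simp add: H_apply h_def row_add T_add plus_ell2.rep_eq)
    show "H (r *\<^sub>R f) = r *\<^sub>R H f" for r f
      by (simp add: scaleR_scaleC H_scaleC)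
    show "norm (H f) \<le> norm f * norm T" for f
      using H_norm[of f] by (simp add: mult.commute)
  qed
  then obtain A where A: "l2op_apply A = H" using l2op_exists H_scaleC by blast
  have row_tensor: "row (x \<otimes>\<^sub>v y) i = ell2_apply x i *\<^sub>C y" for x y i
    by (rule ell2_eqI) (simp add: row_apply tensor_ell2_apply scaleC_ell2.rep_eq)
  have "l2op_apply A (x \<otimes>\<^sub>v y) = x \<otimes>\<^sub>v l2op_apply T y" for x y
  proof (rule ell2_eqI)
    fix p :: "'a \<times> 'b"
    show "ell2_apply (l2op_apply A (x \<otimes>\<^sub>v y)) p = ell2_apply (x \<otimes>\<^sub>v l2op_apply T y) p"
      by (cases p) (simp add: A H_apply h_def row_tensor l2op_apply_scaleC scaleC_ell2.rep_eq
          tensor_ell2_apply)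
  qed
  moreover have "norm A \<le> norm T"
    by (rule norm_l2op_bound) (auto simp: A H_norm)
  ultimately show ?thesis by blast
qed

definition ell2_swap :: "('a \<times> 'b) ell2 \<Rightarrow> ('b \<times> 'a) ell2"
  where "ell2_swap f = Abs_ell2 (\<lambda>p. ell2_apply f (prod.swap p))"

lemma ell2_swap_bound:
  assumes "finite F"
  shows "(\<Sum>p\<in>F. (cmod (ell2_apply f (prod.swap p)))\<^sup>2) \<le> (norm f)\<^sup>2"
proof -
  have "(\<Sum>p\<in>F. (cmod (ell2_apply f (prod.swap p)))\<^sup>2)
      = (\<Sum>p\<in>prod.swap ` F. (cmod (ell2_apply f p))\<^sup>2)"
    by (subst sum.reindex) (auto simp: inj_on_def)
  then show ?thesis using ell2_sum_le_norm[of "prod.swap ` F" f] assms by simp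
qed

lemma ell2_swap_apply: "ell2_apply (ell2_swap f) p = ell2_apply f (prod.swap p)"
  using square_summable_bound[OF ell2_swap_bound, of f]
  by (simp add: ell2_swap_def Abs_ell2_inverse)

lemma ell2_swap_tensor: "ell2_swap (x \<otimes>\<^sub>v y) = y \<otimes>\<^sub>v x"
proof (rule ell2_eqI)
  show "ell2_apply (ell2_swap (x \<otimes>\<^sub>v y)) p = ell2_apply (y \<otimes>\<^sub>v x) p" for p
    by (cases p) (simp add: ell2_swap_apply tensor_ell2_apply)
qed

lemma norm_ell2_swap_le: "norm (ell2_swap f) \<le> norm f"
  by (rule norm_ell2_bound) (auto simp: ell2_swap_apply ell2_swap_bound)

lemma ell2_swap_scaleC: "ell2_swap (c *\<^sub>C f) = c *\<^sub>C ell2_swap f"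
  by (rule ell2_eqI) (simp add: ell2_swap_apply scaleC_ell2.rep_eq)

lemma bounded_linear_ell2_swap: "bounded_linear ell2_swap"
proof (rule bounded_linear_intro[of _ 1])
  show "ell2_swap (f + g) = ell2_swap f + ell2_swap g" for f g :: "('a \<times> 'b) ell2"
    by (rule ell2_eqI) (simp add: ell2_swap_apply plus_ell2.rep_eq)
  show "ell2_swap (r *\<^sub>R f) = r *\<^sub>R ell2_swap f" for r and f :: "('a \<times> 'b) ell2"
    by (simp add: scaleR_scaleC ell2_swap_scaleC)
qed (simp add: norm_ell2_swap_le)

lemma l2op_ampliation_left:
  fixes S :: "'a l2op"
  shows "\<exists>A :: ('a \<times> 'b) l2op. (\<forall>x y. l2op_apply A (x \<otimes>\<^sub>v y) = l2op_apply S x \<otimes>\<^sub>v y) \<and> norm A \<le> norm S"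
proof -
  obtain B :: "('b \<times> 'a) l2op"
    where B: "\<And>x y. l2op_apply B (x \<otimes>\<^sub>v y) = x \<otimes>\<^sub>v l2op_apply S y" "norm B \<le> norm S"
    using l2op_ampliation[of S] by blast
  have "bounded_linear (\<lambda>f. ell2_swap (l2op_apply B (ell2_swap f)))"
    by (intro bounded_linear_compose[OF bounded_linear_ell2_swap]
        bounded_linear_compose[OF bounded_linear_l2op_apply] bounded_linear_ell2_swap)
  then obtain A where A: "l2op_apply A = (\<lambda>f. ell2_swap (l2op_apply B (ell2_swap f)))"
    using l2op_exists by (metis (no_types, lifting) ell2_swap_scaleC l2op_apply_scaleC)
  have "norm A \<le> norm S"
  proof (rule norm_l2op_bound)
    fix f
    have "norm (l2op_apply A f) \<le> norm (l2op_apply B (ell2_swap f))"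
      by (simp add: A norm_ell2_swap_le)
    also have "\<dots> \<le> norm B * norm (ell2_swap f)" by (rule norm_l2op_apply)
    also have "\<dots> \<le> norm S * norm f"
      by (intro mult_mono B norm_ell2_swap_le) auto
    finally show "norm (l2op_apply A f) \<le> norm S * norm f" .
  qed simp
  then show ?thesis by (intro exI[of _ A]) (simp add: A ell2_swap_tensor B)
qed

lemma l2op_eq_tensorI:
  assumes "\<And>x y. l2op_apply U (x \<otimes>\<^sub>v y) = l2op_apply V (x \<otimes>\<^sub>v y)"
  shows "U = V"
proof (rule l2op_eq_ketI)
  show "l2op_apply U (ket p) = l2op_apply V (ket p)" for p
    by (cases p) (simp add: ket_pair assms)
qed

lemma tensor_op_ex:
  "\<exists>U. (\<forall>x y. l2op_apply U (x \<otimes>\<^sub>v y) = l2op_apply S x \<otimes>\<^sub>v l2op_apply T y)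
    \<and> norm U \<le> norm S * norm T"
proof -
  obtain A :: "('a \<times> 'b) l2op"
    where A: "\<And>x y. l2op_apply A (x \<otimes>\<^sub>v y) = l2op_apply S x \<otimes>\<^sub>v y" "norm A \<le> norm S"
    using l2op_ampliation_left[of S] by blast
  obtain B :: "('a \<times> 'b) l2op"
    where B: "\<And>x y. l2op_apply B (x \<otimes>\<^sub>v y) = x \<otimes>\<^sub>v l2op_apply T y" "norm B \<le> norm T"
    using l2op_ampliation[of T] by blast
  have "norm (A * B) \<le> norm S * norm T"
    using norm_mult_ineq[of A B] mult_mono[OF A(2) B(2)] by simp
  then show ?thesis by (intro exI[of _ "A * B"]) (simp add: l2op_apply_mult A B)
qed

lemma tensor_op_ex1:
  "\<exists>!U. \<forall>x y. l2op_apply U (x \<otimes>\<^sub>v y) = l2op_apply S x \<otimes>\<^sub>v l2op_apply T y"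
proof -
  obtain U where "\<forall>x y. l2op_apply U (x \<otimes>\<^sub>v y) = l2op_apply S x \<otimes>\<^sub>v l2op_apply T y"
    using tensor_op_ex by blast
  then show ?thesis by (intro ex1I[of _ U]) (auto intro: l2op_eq_tensorI)
qed

lemma tensor_op_apply:
  "l2op_apply (S \<otimes>\<^sub>o T) (x \<otimes>\<^sub>v y) = l2op_apply S x \<otimes>\<^sub>v l2op_apply T y"
  using theI'[OF tensor_op_ex1[of S T]] unfolding tensor_op_def by blast

lemma norm_tensor_op_le: "norm (S \<otimes>\<^sub>o T) \<le> norm S * norm T"
proof -
  obtain U where U: "\<And>x y. l2op_apply U (x \<otimes>\<^sub>v y) = l2op_apply S x \<otimes>\<^sub>v l2op_apply T y"
    "norm U \<le> norm S * norm T"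
    using tensor_op_ex[of S T] by blast
  have "S \<otimes>\<^sub>o T = U" by (rule l2op_eq_tensorI) (simp add: tensor_op_apply U)
  then show ?thesis using U by simp
qed

section \<open>Minimal tensor norms and the self-absorption property\<close>

definition star_rep :: "('a::cstar_algebra \<Rightarrow> 'h l2op) \<Rightarrow> bool" where
  "star_rep \<rho> \<longleftrightarrow>
    (\<forall>x y. \<rho> (x + y) = \<rho> x + \<rho> y) \<and>
    (\<forall>c x. \<rho> (c *\<^sub>C x) = c *\<^sub>C \<rho> x) \<and>
    (\<forall>x y. \<rho> (x * y) = \<rho> x * \<rho> y) \<and>
    (\<forall>x. \<rho> (star x) = star (\<rho> x))"

text \<open>
  The norms of \<open>\<Sum>i\<in>I. a i \<otimes> b i\<close> in \<open>A \<otimes>\<^bsub>min\<^esub> B\<close> and of \<open>\<Sum>i\<in>I. a i \<otimes> b i \<otimes> c i\<close> in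
  \<open>A \<otimes>\<^bsub>min\<^esub> B \<otimes>\<^bsub>min\<^esub> C\<close>: the supremum of the operator norms over all
  representations of the factors, equivalently the operator norm under any choice of faithful
  representations. Representations of an algebra of type \<open>'a\<close> on the Hilbert space
  \<open>\<ell>\<^sup>2('a)\<close> suffice: every representation is a direct sum of cyclic ones and a zero one,
  and a cyclic one lives on a Hilbert space with a dense subset of cardinality at most
  that of \<open>'a\<close>, hence embeds into \<open>\<ell>\<^sup>2('a)\<close> as a possibly degenerate representation.
\<close>

definition min_norm2 :: "'i set \<Rightarrow> ('i \<Rightarrow> 'a::cstar_algebra) \<Rightarrow> ('i \<Rightarrow> 'b::cstar_algebra) \<Rightarrow> real"
  where "min_norm2 I a b = Sup {norm (\<Sum>i\<in>I. \<rho> (a i) \<otimes>\<^sub>o \<sigma> (b i)) |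
    (\<rho> :: 'a \<Rightarrow> 'a l2op) (\<sigma> :: 'b \<Rightarrow> 'b l2op). star_rep \<rho> \<and> star_rep \<sigma>}"

definition min_norm3 ::
  "'i set \<Rightarrow> ('i \<Rightarrow> 'a::cstar_algebra) \<Rightarrow> ('i \<Rightarrow> 'b::cstar_algebra) \<Rightarrow> ('i \<Rightarrow> 'c::cstar_algebra) \<Rightarrow> real"
  where "min_norm3 I a b c = Sup {norm (\<Sum>i\<in>I. \<rho> (a i) \<otimes>\<^sub>o \<sigma> (b i) \<otimes>\<^sub>o \<tau> (c i)) |
    (\<rho> :: 'a \<Rightarrow> 'a l2op) (\<sigma> :: 'b \<Rightarrow> 'b l2op) (\<tau> :: 'c \<Rightarrow> 'c l2op).
      star_rep \<rho> \<and> star_rep \<sigma> \<and> star_rep \<tau>}"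

text \<open>
  HOL cannot quantify over types inside a definition, so the coefficient algebra is a type
  parameter; a statement with a free type variable \<open>'b\<close> ranges over all C*-algebras.
\<close>

definition SAP :: "'b::cstar_algebra itself \<Rightarrow> ('i \<Rightarrow> 'a::cstar_algebra) \<Rightarrow> bool" where
  "SAP B x \<longleftrightarrow> (\<forall>b :: 'i \<Rightarrow> 'b. finite {i. b i \<noteq> 0} \<longrightarrow>
    min_norm2 {i. b i \<noteq> 0} b x = min_norm3 {i. b i \<noteq> 0} b x (\<lambda>i. to_cconj (x i)))"

text \<open>Both suprema are over nonempty bounded sets, because representations are contractive.\<close>

lemma norm_star: "norm (star x) = norm (x :: 'a :: cstar_algebra)"
proof -
  have le: "norm y \<le> norm (star y)" for y :: 'a
  proof -
    have "norm y * norm y \<le> norm (star y) * norm y"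
      using norm_mult_ineq[of "star y" y] by (simp add: norm_star_mult_self power2_eq_square)
    then show ?thesis by (cases "norm y = 0") auto
  qed
  from le[of x] le[of "star x"] show ?thesis by (simp add: star_star)
qed

lemma star_scaleR: "star (r *\<^sub>R x) = r *\<^sub>R star (x :: 'a :: cstar_algebra)"
  by (simp add: scaleR_scaleC star_scaleC)

lemma star_zero: "star (0 :: 'a :: cstar_algebra) = 0"
  using star_scaleR[of 0 "0 :: 'a"] by simp

lemma bounded_linear_star: "bounded_linear (star :: 'a :: cstar_algebra \<Rightarrow> 'a)"
  by (rule bounded_linear_intro[of _ 1]) (auto simp: star_add star_scaleR norm_star)

lemma cstar_defect_root:
  fixes h :: "'a :: cstar_algebra"
  assumes "norm h < 1" "star h = h"
  shows "\<exists>g. star g = g \<and> h = 2 *\<^sub>R g - g * g"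
proof -
  define r where "r = 1 - sqrt (1 - norm h)"
  have r: "0 \<le> r" "r < 1" using assms(1) by (auto simp: r_def)
  have "(1 - r)\<^sup>2 = 1 - norm h" using assms(1) by (simp add: r_def)
  then have rq: "norm h + r * r = 2 * r" by (simp add: power2_eq_square algebra_simps)
  let ?S = "{g :: 'a. norm g \<le> r \<and> star g = g}"
  let ?f = "\<lambda>g. (1/2) *\<^sub>R (h + g * g)"
  have "closed ?S"
    by (intro closed_Collect_conj closed_Collect_le closed_Collect_eq continuous_intros
        linear_continuous_on bounded_linear_star)
  then have "complete ?S" by (simp add: complete_eq_closed)
  moreover have "0 \<in> ?S" using r by (simp add: star_zero)
  moreover from this have "?S \<noteq> {}" by blast
  moreover have "?f ` ?S \<subseteq> ?S"
  proof safe
    fix g :: 'a assume g: "norm g \<le> r" "star g = g"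
    have "norm (h + g * g) \<le> norm h + r * r"
      using norm_triangle_ineq[of h "g * g"] norm_mult_ineq[of g g]
        mult_mono[OF g(1) g(1)] r by simp
    then show "norm (?f g) \<le> r" using rq by simp
    show "star (?f g) = ?f g" by (simp add: star_scaleR star_add star_mult g assms)
  qed
  moreover have "\<forall>x\<in>?S. \<forall>y\<in>?S. dist (?f x) (?f y) \<le> r * dist x y"
  proof (intro ballI)
    fix x y assume xy: "x \<in> ?S" "y \<in> ?S"
    have "?f x - ?f y = (1/2) *\<^sub>R (x * (x - y) + (x - y) * y)"
      by (simp add: algebra_simps)
    then have "norm (?f x - ?f y) \<le> (norm (x * (x - y)) + norm ((x - y) * y)) / 2"
      using norm_triangle_ineq[of "x * (x - y)" "(x - y) * y"] by simp
    also have "\<dots> \<le> (norm x * norm (x - y) + norm (x - y) * norm y) / 2"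
      by (intro divide_right_mono add_mono norm_mult_ineq) simp
    also have "\<dots> \<le> (r * norm (x - y) + norm (x - y) * r) / 2"
      using xy by (intro divide_right_mono add_mono mult_mono) (auto simp: r)
    finally show "dist (?f x) (?f y) \<le> r * dist x y" by (simp add: dist_norm)
  qed
  ultimately obtain g where "g \<in> ?S" and g: "?f g = g"
    using Banach_fix[of ?S r ?f] r by blast
  have "2 *\<^sub>R g = h + g * g" by (subst g[symmetric]) simp
  then have "h = 2 *\<^sub>R g - g * g" by simp
  then show ?thesis using \<open>g \<in> ?S\<close> by blast
qed

lemma star_rep_norm_le:
  assumes "star_rep \<rho>"
  shows "norm (\<rho> a) \<le> norm a"
proof -
  have add: "\<rho> (x + y) = \<rho> x + \<rho> y" and scaleC: "\<rho> (c *\<^sub>C x) = c *\<^sub>C \<rho> x"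
    and mult: "\<rho> (x * y) = \<rho> x * \<rho> y" and st: "\<rho> (star x) = star (\<rho> x)" for x y c
    using assms by (auto simp: star_rep_def)
  have scaleR: "\<rho> (r *\<^sub>R x) = r *\<^sub>R \<rho> x" for r x by (simp add: scaleR_scaleC scaleC)
  have diff: "\<rho> (x - y) = \<rho> x - \<rho> y" for x y
    using add[of "x - y" y] by simp
  have unit: "norm (\<rho> x) \<le> 1" if "norm x < 1" for x
  proof -
    have "norm (star x * x) < 1" using that by (simp add: norm_star_mult_self abs_square_less_1)
    moreover have "star (star x * x) = star x * x" by (simp add: star_mult star_star)
    ultimately obtain g where g: "star g = g" "star x * x = 2 *\<^sub>R g - g * g"
      using cstar_defect_root by blast
    define G where "G = \<rho> g"
    have G: "star G = G" by (simp add: G_def st[symmetric] g)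
    have eq: "star (\<rho> x) * \<rho> x = 2 *\<^sub>R G - G * G"
      by (simp add: G_def st[symmetric] mult[symmetric] scaleR[symmetric] diff[symmetric] g(2))
    have minus: "l2op_apply (S - T) v = l2op_apply S v - l2op_apply T v" for S T :: "'b l2op" and v
      using l2op_apply_add[of "S - T" T v] by simp
    have star_inner: "inner u (l2op_apply (star T) v) = inner (l2op_apply T u) v"
      for T :: "'b l2op" and u v
      by (simp only: Re_cinner[symmetric] cinner_star_right)
    have "norm (l2op_apply (\<rho> x) v) \<le> 1 * norm v" for v
    proof -
      let ?w = "l2op_apply G v"
      have "(norm (l2op_apply (\<rho> x) v))\<^sup>2 = inner v (l2op_apply (star (\<rho> x) * \<rho> x) v)"
        by (simp add: l2op_apply_mult star_inner power2_norm_eq_inner)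
      also have "\<dots> = 2 * inner v ?w - inner v (l2op_apply G ?w)"
        by (simp add: eq minus l2op_apply_scaleR l2op_apply_mult inner_diff_right)
      also have "inner v (l2op_apply G ?w) = inner ?w ?w"
        using star_inner[of v G ?w] by (simp add: G)
      also have "2 * inner v ?w - inner ?w ?w = (norm v)\<^sup>2 - (norm (v - ?w))\<^sup>2"
        by (simp add: power2_norm_eq_inner inner_diff_left inner_diff_right inner_commute)
      also have "\<dots> \<le> (norm v)\<^sup>2" by simp
      finally have "norm (l2op_apply (\<rho> x) v) \<le> norm v" by (rule power2_le_imp_le) simp
      then show ?thesis by simp
    qed
    then show ?thesis by (intro norm_l2op_bound) auto
  qed
  show ?thesis
  proof (rule dense_ge)
    fix r assume r: "norm a < r"
    then have r0: "0 < r" by (meson norm_ge_zero le_less_trans)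
    have "norm (\<rho> (inverse r *\<^sub>R a)) \<le> 1"
      by (rule unit) (use r r0 in \<open>simp add: field_simps\<close>)
    then show "norm (\<rho> a) \<le> r" using r0 by (simp add: scaleR field_simps)
  qed
qed

lemma star_rep_zero: "star_rep (\<lambda>_. 0)"
  by (simp add: star_rep_def star_zero)

lemma norm_tensor_op_bound:
  assumes "norm S \<le> s" "norm T \<le> t"
  shows "norm (S \<otimes>\<^sub>o T) \<le> s * t"
proof -
  have "norm S * norm T \<le> s * t"
    using assms norm_ge_zero[of S] norm_ge_zero[of T] by (intro mult_mono) linarith+
  then show ?thesis using norm_tensor_op_le[of S T] by linarith
qed

lemma min_norm2_set:
  fixes I :: "'i set" and a :: "'i \<Rightarrow> 'a::cstar_algebra" and b :: "'i \<Rightarrow> 'b::cstar_algebra"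
  defines "N \<equiv> {norm (\<Sum>i\<in>I. \<rho> (a i) \<otimes>\<^sub>o \<sigma> (b i)) |
    (\<rho> :: 'a \<Rightarrow> 'a l2op) (\<sigma> :: 'b \<Rightarrow> 'b l2op). star_rep \<rho> \<and> star_rep \<sigma>}"
  shows "bdd_above N" "N \<noteq> {}"
proof -
  have "x \<le> (\<Sum>i\<in>I. norm (a i) * norm (b i))" if x_in: "x \<in> N" for x
  proof -
    obtain \<rho> :: "'a \<Rightarrow> 'a l2op" and \<sigma> :: "'b \<Rightarrow> 'b l2op"
      where x: "x = norm (\<Sum>i\<in>I. \<rho> (a i) \<otimes>\<^sub>o \<sigma> (b i))" and *: "star_rep \<rho>" "star_rep \<sigma>"
      using x_in unfolding N_def mem_Collect_eq by (elim exE conjE)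
    show ?thesis
      unfolding x by (intro sum_norm_le norm_tensor_op_bound star_rep_norm_le *)
  qed
  then show "bdd_above N" by (rule bdd_aboveI)
  have "norm (\<Sum>i\<in>I. (\<lambda>_. 0 :: 'a l2op) (a i) \<otimes>\<^sub>o (\<lambda>_. 0 :: 'b l2op) (b i)) \<in> N"
    unfolding N_def mem_Collect_eq by (intro exI conjI, rule refl) (rule star_rep_zero)+
  then show "N \<noteq> {}" by (metis empty_iff)
qed

lemma min_norm3_set:
  fixes I :: "'i set" and a :: "'i \<Rightarrow> 'a::cstar_algebra" and b :: "'i \<Rightarrow> 'b::cstar_algebra"
    and c :: "'i \<Rightarrow> 'c::cstar_algebra"
  defines "N \<equiv> {norm (\<Sum>i\<in>I. \<rho> (a i) \<otimes>\<^sub>o \<sigma> (b i) \<otimes>\<^sub>o \<tau> (c i)) |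
    (\<rho> :: 'a \<Rightarrow> 'a l2op) (\<sigma> :: 'b \<Rightarrow> 'b l2op) (\<tau> :: 'c \<Rightarrow> 'c l2op).
      star_rep \<rho> \<and> star_rep \<sigma> \<and> star_rep \<tau>}"
  shows "bdd_above N" "N \<noteq> {}"
proof -
  have "x \<le> (\<Sum>i\<in>I. norm (a i) * (norm (b i) * norm (c i)))" if x_in: "x \<in> N" for x
  proof -
    obtain \<rho> :: "'a \<Rightarrow> 'a l2op" and \<sigma> :: "'b \<Rightarrow> 'b l2op" and \<tau> :: "'c \<Rightarrow> 'c l2op"
      where x: "x = norm (\<Sum>i\<in>I. \<rho> (a i) \<otimes>\<^sub>o \<sigma> (b i) \<otimes>\<^sub>o \<tau> (c i))"
        and *: "star_rep \<rho>" "star_rep \<sigma>" "star_rep \<tau>"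
      using x_in unfolding N_def mem_Collect_eq by (elim exE conjE)
    show ?thesis
      unfolding x by (intro sum_norm_le norm_tensor_op_bound star_rep_norm_le *)
  qed
  then show "bdd_above N" by (rule bdd_aboveI)
  have "norm (\<Sum>i\<in>I. (\<lambda>_. 0 :: 'a l2op) (a i) \<otimes>\<^sub>o (\<lambda>_. 0 :: 'b l2op) (b i)
      \<otimes>\<^sub>o (\<lambda>_. 0 :: 'c l2op) (c i)) \<in> N"
    unfolding N_def mem_Collect_eq by (intro exI conjI, rule refl) (rule star_rep_zero)+
  then show "N \<noteq> {}" by (metis empty_iff)
qed

section \<open>The Hankel system of a cancellative monoid\<close>

class cancellative_monoid = monoid_mult +
  assumes cancellative: "a * b * c = a * d * c \<Longrightarrow> b = d"

definition matrix_entry :: "'a l2op \<Rightarrow> 'a \<Rightarrow> 'a \<Rightarrow> complex"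
  where "matrix_entry T i j = cinner (ket i) (l2op_apply T (ket j))"

definition hankel :: "'m::cancellative_monoid \<Rightarrow> 'm l2op" where
  "hankel t = (THE T. \<forall>s1 s2. matrix_entry T s1 s2 = (if s1 * s2 = t then 1 else 0))"

lemma matrix_entry_eqI:
  assumes "\<And>i j. matrix_entry S i j = matrix_entry T i j"
  shows "S = T"
  using assms by (intro l2op_eq_ketI ell2_eqI) (simp add: matrix_entry_def cinner_ket_left)

lemma hankel_ex1:
  fixes t :: "'m::cancellative_monoid"
  shows "\<exists>!T. \<forall>s1 s2. matrix_entry T s1 s2 = (if s1 * s2 = t then 1 else 0)"
proof -
  have left: "b = d" if "a * b = a * d" for a b d :: 'm
    using that cancellative[of a b 1 d] by simp
  have right: "b = d" if "b * c = d * c" for b c d :: 'm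
    using that cancellative[of 1 b c d] by simp
  define D where "D = {s :: 'm. \<exists>u. s * u = t}"
  define m where "m s = (THE u. s * u = t)" for s
  have m: "m s = u" if "s * u = t" for s u
    unfolding m_def using that left by (intro the_equality) auto
  have m': "s * m s = t" if "s \<in> D" for s
    using that m unfolding D_def by blast
  have inj: "inj_on m D" by (rule inj_onI) (metis m' right)
  define g where "g f s = (if s \<in> D then ell2_apply f (m s) else 0)" for f s
  have g_bound: "(\<Sum>s\<in>F. (cmod (g f s))\<^sup>2) \<le> (norm f)\<^sup>2" if F: "finite F" for f F
  proof -
    have "(\<Sum>s\<in>F. (cmod (g f s))\<^sup>2) = (\<Sum>s\<in>F \<inter> D. (cmod (ell2_apply f (m s)))\<^sup>2)"
      using F by (intro sum.mono_neutral_cong_right) (auto simp: g_def)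
    also have "\<dots> = (\<Sum>u\<in>m ` (F \<inter> D). (cmod (ell2_apply f u))\<^sup>2)"
      by (simp add: sum.reindex inj_on_subset[OF inj])
    also have "\<dots> \<le> (norm f)\<^sup>2" using F by (intro ell2_sum_le_norm) simp
    finally show ?thesis .
  qed
  define G where "G f = Abs_ell2 (g f)" for f
  have G_apply: "ell2_apply (G f) = g f" for f
    using square_summable_bound[OF g_bound, of f] by (simp add: G_def Abs_ell2_inverse)
  have G_scaleC: "G (c *\<^sub>C f) = c *\<^sub>C G f" for c f
    by (rule ell2_eqI) (simp add: G_apply g_def scaleC_ell2.rep_eq)
  have "bounded_linear G"
  proof (rule bounded_linear_intro[of _ 1])
    show "G (f + h) = G f + G h" for f h
      by (rule ell2_eqI) (simp add: G_apply g_def plus_ell2.rep_eq)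
    show "G (r *\<^sub>R f) = r *\<^sub>R G f" for r f
      by (simp add: scaleR_scaleC G_scaleC)
    show "norm (G f) \<le> norm f * 1" for f
      by (rule norm_ell2_bound) (use g_bound[of _ f] in \<open>auto simp: G_apply\<close>)
  qed
  then obtain T where T: "l2op_apply T = G" using l2op_exists G_scaleC by blast
  have "matrix_entry T s1 s2 = (if s1 * s2 = t then 1 else 0)" for s1 s2
  proof (cases "s1 * s2 = t")
    case True
    then have "s1 \<in> D" by (auto simp: D_def)
    then show ?thesis
      using True by (simp add: matrix_entry_def cinner_ket_left T G_apply g_def m[OF True] ket.rep_eq)
  next
    case False
    then show ?thesis
      using m' by (auto simp: matrix_entry_def cinner_ket_left T G_apply g_def ket.rep_eq)
  qed
  then show ?thesis by (intro ex1I[of _ T]) (auto intro: matrix_entry_eqI)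
qed

lemma matrix_entry_hankel:
  "matrix_entry (hankel t) s1 s2 = (if s1 * s2 = t then 1 else 0)"
  using theI'[OF hankel_ex1[of t]] unfolding hankel_def by blast

end

theory Submission
  imports Defs
begin

text \<open>
  Write \<open>\<Gamma>\<^sub>t\<close> for \<open>hankel t\<close>. Its matrix has real entries, so under the identification of the
  conjugate of \<open>B(\<ell>\<^sup>2('m))\<close> with \<open>B(\<ell>\<^sup>2('m))\<close> given by entrywise conjugation it is its own
  conjugate, and the claim is that \<open>X = \<Sum>t. b t \<otimes> \<Gamma>\<^sub>t\<close> and \<open>Y = \<Sum>t. b t \<otimes> \<Gamma>\<^sub>t \<otimes> \<Gamma>\<^sub>t\<close> have
  the same norm.

  One may represent \<open>b\<close> concretely and use the identity representation for \<open>\<Gamma>\<close>. The minimal norms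
  are suprema over all representations of \<open>B(\<ell>\<^sup>2('m))\<close>, but none of them gives a larger norm than
  the identity (\<open>norm_sum_tensor_rep_le\<close>), because representations are completely contractive: on
  matrices over \<open>B(\<ell>\<^sup>2('m))\<close> an entrywise representation is bounded, and a bounded
  \<open>*\<close>-homomorphism is contractive by the \<open>C\<^sup>*\<close>-identity. Conversely the identity occurs among the
  admissible representations once \<open>\<ell>\<^sup>2('m)\<close> is embedded in the larger Hilbert space prescribed by
  the suprema (\<open>star_rep_embed\<close>).

  Now compare matrices with operator entries. The entry of \<open>X\<close> at \<open>a\<close>, \<open>x\<close> is \<open>b (a x)\<close>; the
  entry of \<open>Y\<close> at \<open>(a, c)\<close>, \<open>(x, y)\<close> is \<open>b (a x)\<close> if \<open>a x = c y\<close> and \<open>0\<close> otherwise. Restricted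
  to the diagonals \<open>(a, a)\<close>, \<open>(x, x)\<close> the matrix of \<open>Y\<close> is that of \<open>X\<close>, so \<open>\<parallel>X\<parallel> \<le> \<parallel>Y\<parallel>\<close>. For
  the other inequality the lunar condition is exactly what makes \<open>a x = c y\<close>, as a relation between
  \<open>(a, c)\<close> and \<open>(x, y)\<close>, a disjoint union of rectangles with disjoint rows and disjoint columns.
  Hence \<open>Y\<close> is an orthogonal direct sum of its restrictions to these rectangles, and by cancellation
  each of those is a submatrix of \<open>X\<close> (\<open>norm_le_rectangular\<close>, \<open>norm_hankel_square_le\<close>).
\<close>

section \<open>Operators and their matrices\<close>

lemma matrix_entry_eq_apply: "matrix_entry T i j = ell2_apply (l2op_apply T (ket j)) i"
  by (simp add: matrix_entry_def cinner_ket_left)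

lemma l2op_apply_zero: "l2op_apply T 0 = 0"
  by (rule linear_0[OF bounded_linear.linear[OF bounded_linear_l2op_apply]])

lemma matrix_entry_add: "matrix_entry (S + T) i j = matrix_entry S i j + matrix_entry T i j"
  by (simp add: matrix_entry_eq_apply l2op_apply_add plus_ell2.rep_eq)

lemma matrix_entry_zero: "matrix_entry 0 i j = 0"
  using matrix_entry_add[of 0 0 i j] by simp

lemma matrix_entry_sum: "matrix_entry (\<Sum>i\<in>I. T i) p q = (\<Sum>i\<in>I. matrix_entry (T i) p q)"
  by (induction I rule: infinite_finite_induct) (auto simp: matrix_entry_add matrix_entry_zero)

lemma matrix_entry_scaleC: "matrix_entry (c *\<^sub>C T) i j = c * matrix_entry T i j"
  by (simp add: matrix_entry_eq_apply scaleC_l2op_apply scaleC_ell2.rep_eq)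

lemma matrix_entry_star: "matrix_entry (star T) i j = cnj (matrix_entry T j i)"
  unfolding matrix_entry_def by (metis cinner_commute cinner_star_right)

lemma matrix_entry_tensor_op:
  "matrix_entry (S \<otimes>\<^sub>o T) (i, k) (j, l) = matrix_entry S i j * matrix_entry T k l"
  by (simp add: matrix_entry_eq_apply ket_pair tensor_op_apply tensor_ell2_apply)

lemma matrix_entry_hankel_square:
  "matrix_entry (hankel t) i j * matrix_entry (hankel t) i j = matrix_entry (hankel t) i j"
  by (simp add: matrix_entry_hankel)

lemma tensor_op_sum_left: "(\<Sum>i\<in>I. S i) \<otimes>\<^sub>o T = (\<Sum>i\<in>I. S i \<otimes>\<^sub>o T)"
  by (rule matrix_entry_eqI)
    (auto simp: split_paired_all matrix_entry_tensor_op matrix_entry_sum sum_distrib_right)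

lemma tensor_op_sum_right: "S \<otimes>\<^sub>o (\<Sum>i\<in>I. T i) = (\<Sum>i\<in>I. S \<otimes>\<^sub>o T i)"
  by (rule matrix_entry_eqI)
    (auto simp: split_paired_all matrix_entry_tensor_op matrix_entry_sum sum_distrib_left)

lemma tensor_op_mult: "(S \<otimes>\<^sub>o T) * (S' \<otimes>\<^sub>o T') = (S * S') \<otimes>\<^sub>o (T * T')"
  by (rule l2op_eq_tensorI) (simp add: l2op_apply_mult tensor_op_apply)

text \<open>Vectors are norm-convergent sums of their coordinates, so the basis determines a functional.\<close>

lemma ell2_functional_eqI:
  assumes "bounded_linear f" "\<And>c v. f (c *\<^sub>C v) = c * f v"
    and "bounded_linear g" "\<And>c v. g (c *\<^sub>C v) = c * g v"
    and ket: "\<And>i. f (ket i) = g (ket i)"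
  shows "f v = (g v :: complex)"
proof -
  have "((\<lambda>i. ell2_apply v i * h (ket i)) has_sum h v) UNIV"
    if "bounded_linear h" "\<And>c v. h (c *\<^sub>C v) = c * h v" for h
    using has_sum_bounded_linear[OF that(1) has_sum_ket[of v]] by (simp add: that(2))
  from this[of f] this[of g] show ?thesis
    unfolding ket using assms(1-4) has_sum_unique by metis
qed

lemma bounded_linear_ell2_apply: "bounded_linear (\<lambda>v. ell2_apply v i)"
  using bounded_linear_cinner_right[of "ket i"] by (simp add: cinner_ket_left[abs_def])

lemma bounded_linear_entry_functional: "bounded_linear (\<lambda>v. ell2_apply (l2op_apply T v) i)"
  by (rule bounded_linear_compose[OF bounded_linear_ell2_apply bounded_linear_l2op_apply])

section \<open>Partial changes of coordinates\<close>

text \<open>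
  For \<open>f\<close> injective on \<open>D\<close> this is the partial isometry taking the basis vector at \<open>f j\<close> to the one
  at \<open>j\<close>. It is a plain function because the operator type only has endomorphisms.
\<close>

definition ell2_pull :: "'b set \<Rightarrow> ('b \<Rightarrow> 'a) \<Rightarrow> 'a ell2 \<Rightarrow> 'b ell2"
  where "ell2_pull D f v = Abs_ell2 (\<lambda>j. if j \<in> D then ell2_apply v (f j) else 0)"

lemma ell2_pull_sum_le:
  assumes "inj_on f D" "finite F"
  shows "(\<Sum>j\<in>F. (cmod (if j \<in> D then ell2_apply v (f j) else 0))\<^sup>2) \<le> (norm v)\<^sup>2"
proof -
  have "(\<Sum>j\<in>F. (cmod (if j \<in> D then ell2_apply v (f j) else 0))\<^sup>2)
      = (\<Sum>j\<in>F \<inter> D. (cmod (ell2_apply v (f j)))\<^sup>2)"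
    using assms by (intro sum.mono_neutral_cong_right) auto
  also have "\<dots> = (\<Sum>i\<in>f ` (F \<inter> D). (cmod (ell2_apply v i))\<^sup>2)"
    using assms by (simp add: sum.reindex inj_on_subset[OF assms(1)])
  also have "\<dots> \<le> (norm v)\<^sup>2" using assms by (intro ell2_sum_le_norm) simp
  finally show ?thesis .
qed

lemma ell2_apply_pull:
  "inj_on f D \<Longrightarrow> ell2_apply (ell2_pull D f v) j = (if j \<in> D then ell2_apply v (f j) else 0)"
  using square_summable_bound[OF ell2_pull_sum_le, of f D v]
  by (simp add: ell2_pull_def Abs_ell2_inverse)

lemma ell2_pull_scaleC:
  "inj_on f D \<Longrightarrow> ell2_pull D f (c *\<^sub>C v) = c *\<^sub>C ell2_pull D f v"
  by (rule ell2_eqI) (simp add: ell2_apply_pull scaleC_ell2.rep_eq)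

lemma bounded_linear_ell2_pull:
  assumes "inj_on f D"
  shows "bounded_linear (ell2_pull D f)"
proof (rule bounded_linear_intro[of _ 1])
  show "ell2_pull D f (v + w) = ell2_pull D f v + ell2_pull D f w" for v w
    by (rule ell2_eqI) (simp add: ell2_apply_pull assms plus_ell2.rep_eq)
  show "ell2_pull D f (r *\<^sub>R v) = r *\<^sub>R ell2_pull D f v" for r v
    by (simp add: scaleR_scaleC ell2_pull_scaleC assms)
  show "norm (ell2_pull D f v) \<le> norm v * 1" for v
    using ell2_pull_sum_le[OF assms, of _ v]
    by (simp add: norm_ell2_bound ell2_apply_pull assms)
qed

lemma norm_ell2_pull_squared:
  assumes "inj_on f D"
  shows "(norm (ell2_pull D f v))\<^sup>2 = (\<Sum>\<^sub>\<infinity>i\<in>f ` D. (cmod (ell2_apply v i))\<^sup>2)"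
proof -
  have "(norm (ell2_pull D f v))\<^sup>2 = (\<Sum>\<^sub>\<infinity>j\<in>D. (cmod (ell2_apply v (f j)))\<^sup>2)"
    unfolding norm_ell2_squared
    by (rule infsum_cong_neutral) (auto simp: ell2_apply_pull assms)
  then show ?thesis by (simp add: infsum_reindex[OF assms] o_def)
qed

lemma sum_norm_ell2_disjoint_parts:
  assumes "finite C" "disjoint C"
  shows "(\<Sum>\<alpha>\<in>C. \<Sum>\<^sub>\<infinity>i\<in>\<alpha>. (cmod (ell2_apply v i))\<^sup>2) \<le> (norm v)\<^sup>2"
proof -
  have summable: "(\<lambda>i. (cmod (ell2_apply v i))\<^sup>2) summable_on A" for A
    using summable_on_subset_banach[OF ell2_square_summable[of v] subset_UNIV[of A]] .
  from assms have "(\<Sum>\<alpha>\<in>C. \<Sum>\<^sub>\<infinity>i\<in>\<alpha>. (cmod (ell2_apply v i))\<^sup>2)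
      = (\<Sum>\<^sub>\<infinity>i\<in>\<Union>C. (cmod (ell2_apply v i))\<^sup>2)"
  proof (induction C rule: finite_induct)
    case (insert \<alpha> C)
    have "\<alpha> \<inter> \<Union>C = {}"
      using insert.prems insert.hyps(2) by (auto simp: pairwise_insert disjnt_iff)
    then have "infsum (\<lambda>i. (cmod (ell2_apply v i))\<^sup>2) (\<alpha> \<union> \<Union>C)
        = infsum (\<lambda>i. (cmod (ell2_apply v i))\<^sup>2) \<alpha> + infsum (\<lambda>i. (cmod (ell2_apply v i))\<^sup>2) (\<Union>C)"
      by (intro infsum_Un_disjoint summable)
    moreover have "disjoint C" using insert.prems by (simp add: pairwise_insert)
    ultimately show ?case
      using insert.IH insert.hyps by simp
  qed simp
  also have "\<dots> \<le> (norm v)\<^sup>2"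
    unfolding norm_ell2_squared by (rule infsum_mono_neutral) (auto simp: summable)
  finally show ?thesis .
qed

section \<open>Cutting a matrix along disjoint rectangles\<close>

text \<open>
  A relation satisfying \<open>rect\<close> is a disjoint union of rectangles with pairwise disjoint sides:
  two rows have either the same support or disjoint supports. On each rectangle the matrix of
  \<open>Y\<close> is, by injectivity of \<open>r\<close> and \<open>s\<close> there, a submatrix of \<open>X\<close>, so \<open>Y\<close> is an orthogonal
  direct sum of operators of norm at most \<open>\<parallel>X\<parallel>\<close>. When \<open>R\<close> is always true there is a single
  rectangle, and \<open>Y\<close> is just a submatrix of \<open>X\<close>.
\<close>

lemma norm_le_rectangular:
  fixes X :: "'a l2op" and Y :: "'b l2op"
  assumes entry: "\<And>p q. matrix_entry Y p q = (if R p q then matrix_entry X (r p) (s q) else 0)"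
    and rect: "\<And>p q p' q'. R p q \<Longrightarrow> R p' q \<Longrightarrow> R p q' \<Longrightarrow> R p' q'"
    and inj_row: "\<And>p q q'. R p q \<Longrightarrow> R p q' \<Longrightarrow> s q = s q' \<Longrightarrow> q = q'"
    and inj_col: "\<And>p p' q. R p q \<Longrightarrow> R p' q \<Longrightarrow> r p = r p' \<Longrightarrow> p = p'"
  shows "norm Y \<le> norm X"
proof (rule norm_l2op_bound)
  fix v
  define N where "N p = {q. R p q}" for p
  \<comment> \<open>The part of a vector supported on \<open>\<alpha>\<close>, moved to the coordinates of \<open>X\<close> by \<open>s\<close>.\<close>
  define part where "part \<alpha> = ell2_pull (s ` \<alpha>) (inv_into \<alpha> s)" for \<alpha>
  have inj: "inj_on s (N p)" for p
    using inj_row by (auto simp: inj_on_def N_def)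
  have inj_inv: "inj_on (inv_into (N p) s) (s ` N p)" for p
    by (rule inj_on_inv_into) simp
  have image_inv: "inv_into (N p) s ` s ` N p = N p" for p
    by (simp add: inj image_image inv_into_f_f)
  \<comment> \<open>Row \<open>p\<close> of \<open>Y\<close> sees only the part of a vector in the rectangle of \<open>p\<close>, on which it acts as row
    \<open>r p\<close> of \<open>X\<close>.\<close>
  have row: "ell2_apply (l2op_apply Y w) p = ell2_apply (l2op_apply X (part (N p) w)) (r p)"
    for w p
  proof (rule ell2_functional_eqI[where v = w
        and f = "\<lambda>w. ell2_apply (l2op_apply Y w) p"
        and g = "\<lambda>w. ell2_apply (l2op_apply X (part (N p) w)) (r p)"])
    show "bounded_linear (\<lambda>w. ell2_apply (l2op_apply Y w) p)"
      by (rule bounded_linear_entry_functional)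
    show "bounded_linear (\<lambda>w. ell2_apply (l2op_apply X (part (N p) w)) (r p))"
      unfolding part_def
      by (intro bounded_linear_compose[OF bounded_linear_entry_functional]
          bounded_linear_ell2_pull inj_inv)
    fix q
    have "part (N p) (ket q) = (if q \<in> N p then ket (s q) else 0)"
    proof (rule ell2_eqI)
      fix j
      show "ell2_apply (part (N p) (ket q)) j = ell2_apply (if q \<in> N p then ket (s q) else 0) j"
        unfolding part_def ell2_apply_pull[OF inj_inv]
        by (auto simp: ket.rep_eq zero_ell2.rep_eq inv_into_f_f[OF inj])
    qed
    moreover have "l2op_apply X 0 = 0"
      by (rule l2op_apply_zero)
    ultimately show "ell2_apply (l2op_apply Y (ket q)) p
        = ell2_apply (l2op_apply X (part (N p) (ket q))) (r p)"
      using entry[of p q] by (auto simp: matrix_entry_eq_apply N_def zero_ell2.rep_eq)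
  qed (auto simp: l2op_apply_scaleC scaleC_ell2.rep_eq part_def ell2_pull_scaleC inj_inv)
  show "norm (l2op_apply Y v) \<le> norm X * norm v"
  proof (rule norm_ell2_bound)
    fix F :: "'b set" assume F: "finite F"
    define G where "G = {p \<in> F. N p \<noteq> {}}"
    have G: "finite G" using F by (simp add: G_def)
    have zero: "ell2_apply (l2op_apply Y v) p = 0" if "N p = {}" for p
    proof -
      have "part {} v = 0" by (rule ell2_eqI) (simp add: part_def ell2_apply_pull zero_ell2.rep_eq)
      then show ?thesis
        by (simp add: row that l2op_apply_zero zero_ell2.rep_eq)
    qed
    have "(\<Sum>p\<in>F. (cmod (ell2_apply (l2op_apply Y v) p))\<^sup>2)
        = (\<Sum>p\<in>G. (cmod (ell2_apply (l2op_apply X (part (N p) v)) (r p)))\<^sup>2)"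
      using F zero by (intro sum.mono_neutral_cong_right) (auto simp: G_def row)
    also have "\<dots> = (\<Sum>\<alpha>\<in>N ` G. \<Sum>p\<in>{p \<in> G. N p = \<alpha>}.
        (cmod (ell2_apply (l2op_apply X (part (N p) v)) (r p)))\<^sup>2)"
      by (rule sum.image_gen[OF G])
    also have "\<dots> \<le> (\<Sum>\<alpha>\<in>N ` G. (norm (l2op_apply X (part \<alpha> v)))\<^sup>2)"
    proof (rule sum_mono)
      fix \<alpha>
      have "inj_on r {p \<in> G. N p = \<alpha>}"
      proof (rule inj_onI)
        fix p p' assume p: "p \<in> {p \<in> G. N p = \<alpha>}" "p' \<in> {p \<in> G. N p = \<alpha>}" "r p = r p'"
        then obtain q where "q \<in> \<alpha>" by (auto simp: G_def)
        then have "R p q" "R p' q" using p(1,2) by (auto simp: N_def)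
        then show "p = p'" using p(3) by (rule inj_col)
      qed
      then have "(\<Sum>p\<in>{p \<in> G. N p = \<alpha>}.
            (cmod (ell2_apply (l2op_apply X (part (N p) v)) (r p)))\<^sup>2)
          = (\<Sum>i\<in>r ` {p \<in> G. N p = \<alpha>}. (cmod (ell2_apply (l2op_apply X (part \<alpha> v)) i))\<^sup>2)"
        by (simp add: sum.reindex)
      also have "\<dots> \<le> (norm (l2op_apply X (part \<alpha> v)))\<^sup>2"
        using G by (intro ell2_sum_le_norm) simp
      finally show "(\<Sum>p\<in>{p \<in> G. N p = \<alpha>}.
          (cmod (ell2_apply (l2op_apply X (part (N p) v)) (r p)))\<^sup>2)
        \<le> (norm (l2op_apply X (part \<alpha> v)))\<^sup>2" .
    qed
    also have "\<dots> \<le> (\<Sum>\<alpha>\<in>N ` G. (norm X)\<^sup>2 * (norm (part \<alpha> v))\<^sup>2)"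
      unfolding power_mult_distrib[symmetric]
      by (intro sum_mono power_mono norm_l2op_apply) simp
    also have "\<dots> = (norm X)\<^sup>2 * (\<Sum>\<alpha>\<in>N ` G. \<Sum>\<^sub>\<infinity>i\<in>\<alpha>. (cmod (ell2_apply v i))\<^sup>2)"
      unfolding sum_distrib_left
      by (intro sum.cong refl) (auto simp: part_def norm_ell2_pull_squared inj_inv image_inv)
    also have "\<dots> \<le> (norm X)\<^sup>2 * (norm v)\<^sup>2"
    proof (intro mult_left_mono sum_norm_ell2_disjoint_parts)
      have "N p \<subseteq> N p'" if "R p q" "R p' q" for p p' q
        using rect[OF that] by (auto simp: N_def)
      then have "N p = N p' \<or> N p \<inter> N p' = {}" for p p'
        by (metis (mono_tags, lifting) N_def disjoint_iff mem_Collect_eq subset_antisym)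
      then show "disjoint (N ` G)"
        unfolding disjoint_def by blast
    qed (use G in auto)
    finally show "(\<Sum>p\<in>F. (cmod (ell2_apply (l2op_apply Y v) p))\<^sup>2) \<le> (norm X * norm v)\<^sup>2"
      by (simp add: power_mult_distrib)
  qed simp
qed simp

lemma norm_le_submatrix:
  fixes X :: "'a l2op" and Y :: "'b l2op"
  assumes "inj r" "inj s" "\<And>p q. matrix_entry Y p q = matrix_entry X (r p) (s q)"
  shows "norm Y \<le> norm X"
  by (rule norm_le_rectangular[where R = "\<lambda>_ _. True" and r = r and s = s])
    (simp_all add: assms(3) inj_eq[OF assms(1)] inj_eq[OF assms(2)])

text \<open>Only finite sections need to be bounded, since finitely supported vectors are dense.\<close>

lemma norm_le_finite_sections:
  fixes Z :: "('k \<times> 'h) l2op"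
  assumes "\<And>F. finite F \<Longrightarrow> \<exists>W. norm W \<le> C \<and>
    (\<forall>p q. matrix_entry W p q = (if fst p \<in> F \<and> fst q \<in> F then matrix_entry Z p q else 0))"
  shows "norm Z \<le> C"
proof (rule norm_l2op_bound)
  obtain W :: "('k \<times> 'h) l2op" where "norm W \<le> C" using assms[of "{}"] by auto
  then show C: "0 \<le> C" using norm_ge_zero[of W] by linarith
  fix v :: "('k \<times> 'h) ell2"
  let ?v = "\<lambda>H. \<Sum>q\<in>H. ell2_apply v q *\<^sub>C ket q"
  have fin: "norm (l2op_apply Z (?v H)) \<le> C * norm (?v H)" if H: "finite H" for H
  proof (rule norm_ell2_bound)
    fix G :: "('k \<times> 'h) set" assume G: "finite G"
    \<comment> \<open>The finite section is chosen to contain both the support of the vector and the coordinates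
      of the image that are tested.\<close>
    have "finite (fst ` (G \<union> H))" using G H by simp
    then obtain W where W: "norm W \<le> C" and entry: "\<And>p q. matrix_entry W p q =
        (if fst p \<in> fst ` (G \<union> H) \<and> fst q \<in> fst ` (G \<union> H) then matrix_entry Z p q else 0)"
      using assms by metis
    have app: "ell2_apply (l2op_apply T (?v H)) p
        = (\<Sum>q\<in>H. ell2_apply v q * matrix_entry T p q)" for T :: "('k \<times> 'h) l2op" and p
      by (simp add: linear_sum[OF bounded_linear.linear[OF bounded_linear_l2op_apply]]
          ell2_apply_sum l2op_apply_scaleC scaleC_ell2.rep_eq matrix_entry_eq_apply)
    have "(\<Sum>p\<in>G. (cmod (ell2_apply (l2op_apply Z (?v H)) p))\<^sup>2)
        = (\<Sum>p\<in>G. (cmod (ell2_apply (l2op_apply W (?v H)) p))\<^sup>2)"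
      unfolding app by (intro sum.cong refl arg_cong[where f = "\<lambda>z. (cmod z)\<^sup>2"]) (simp add: entry)
    also have "\<dots> \<le> (norm (l2op_apply W (?v H)))\<^sup>2" by (rule ell2_sum_le_norm[OF G])
    also have "\<dots> \<le> (C * norm (?v H))\<^sup>2"
      using norm_l2op_apply[of W "?v H"] mult_right_mono[OF W norm_ge_zero[of "?v H"]]
      by (intro power_mono) auto
    finally show "(\<Sum>p\<in>G. (cmod (ell2_apply (l2op_apply Z (?v H)) p))\<^sup>2) \<le> (C * norm (?v H))\<^sup>2" .
  qed (use C in simp)
  have lim: "(?v \<longlongrightarrow> v) (finite_subsets_at_top UNIV)"
    using has_sum_ket[of v] by (simp add: has_sum_def)
  show "norm (l2op_apply Z v) \<le> C * norm v"
  proof (rule tendsto_le)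
    show "((\<lambda>H. C * norm (?v H)) \<longlongrightarrow> C * norm v) (finite_subsets_at_top UNIV)"
      by (intro tendsto_intros lim)
    show "((\<lambda>H. norm (l2op_apply Z (?v H))) \<longlongrightarrow> norm (l2op_apply Z v)) (finite_subsets_at_top UNIV)"
      by (intro tendsto_norm bounded_linear.tendsto[OF bounded_linear_l2op_apply] lim)
    show "\<forall>\<^sub>F H in finite_subsets_at_top UNIV. norm (l2op_apply Z (?v H)) \<le> C * norm (?v H)"
      by (rule eventually_finite_subsets_at_top_weakI) (rule fin)
  qed simp
qed

section \<open>Amplifications of representations are contractive\<close>

definition matrix_unit :: "'k \<Rightarrow> 'k \<Rightarrow> 'k l2op"
  where "matrix_unit i j = (SOME T. \<forall>v. l2op_apply T v = ell2_apply v j *\<^sub>C ket i)"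

lemma matrix_unit_apply: "l2op_apply (matrix_unit i j) v = ell2_apply v j *\<^sub>C ket i"
proof -
  have "bounded_linear (\<lambda>v. ell2_apply v j *\<^sub>C ket i)"
  proof (rule bounded_linear_intro[of _ 1])
    show "norm (ell2_apply v j *\<^sub>C ket i) \<le> norm v * 1" for v
      by (simp add: norm_scaleC ell2_apply_le_norm)
  qed (simp_all add: plus_ell2.rep_eq scaleR_ell2.rep_eq scaleC_add_left scaleR_scaleC scaleC_ell2.rep_eq
      scaleC_scaleC)
  then obtain T where "l2op_apply T = (\<lambda>v. ell2_apply v j *\<^sub>C ket i)"
    by (rule l2op_exists[THEN exE]) (simp_all add: scaleC_ell2.rep_eq scaleC_scaleC)
  then have "\<exists>T. \<forall>v. l2op_apply T v = ell2_apply v j *\<^sub>C ket i" by metis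
  from someI_ex[OF this] show ?thesis unfolding matrix_unit_def by blast
qed

lemma matrix_entry_matrix_unit:
  "matrix_entry (matrix_unit i j) k l = (if i = k \<and> j = l then 1 else 0)"
  by (auto simp: matrix_entry_eq_apply matrix_unit_apply ket.rep_eq scaleC_ell2.rep_eq)

lemma matrix_unit_mult:
  "matrix_unit i j * matrix_unit k l = (if j = k then matrix_unit i l else 0)"
proof (rule matrix_entry_eqI)
  fix p q
  show "matrix_entry (matrix_unit i j * matrix_unit k l) p q
      = matrix_entry (if j = k then matrix_unit i l else 0) p q"
    by (auto simp: matrix_entry_eq_apply l2op_apply_mult matrix_unit_apply ket.rep_eq
        scaleC_ell2.rep_eq matrix_entry_zero[unfolded matrix_entry_eq_apply])
qed

text \<open>
  Finite matrices over \<open>B(\<ell>\<^sup>2('h))\<close>, with size depending on \<open>F\<close>, all act on the single Hilbert space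
  \<open>\<ell>\<^sup>2('k) \<otimes> \<ell>\<^sup>2('h)\<close>, as \<open>0\<close> off the coordinates in \<open>F\<close>.
\<close>

definition block_matrix :: "'k set \<Rightarrow> ('k \<Rightarrow> 'k \<Rightarrow> 'h l2op) \<Rightarrow> ('k \<times> 'h) l2op"
  where "block_matrix F a = (\<Sum>i\<in>F. \<Sum>j\<in>F. matrix_unit i j \<otimes>\<^sub>o a i j)"

lemma matrix_entry_block_matrix:
  assumes "finite F"
  shows "matrix_entry (block_matrix F a) (k, p) (l, q)
    = (if k \<in> F \<and> l \<in> F then matrix_entry (a k l) p q else 0)"
proof -
  have "matrix_entry (block_matrix F a) (k, p) (l, q)
      = (\<Sum>i\<in>F. \<Sum>j\<in>F. if k = i \<and> l = j then matrix_entry (a i j) p q else 0)"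
    unfolding block_matrix_def matrix_entry_sum matrix_entry_tensor_op matrix_entry_matrix_unit
    by (intro sum.cong refl) auto
  also have "\<dots> = (\<Sum>i\<in>F. if k = i then (if l \<in> F then matrix_entry (a i l) p q else 0) else 0)"
    using assms by (intro sum.cong refl) auto
  also have "\<dots> = (if k \<in> F \<and> l \<in> F then matrix_entry (a k l) p q else 0)"
    using assms by simp
  finally show ?thesis .
qed

lemma block_matrix_mult:
  assumes "finite F"
  shows "block_matrix F a * block_matrix F b = block_matrix F (\<lambda>i j. \<Sum>k\<in>F. a i k * b k j)"
proof -
  let ?E = "\<lambda>i k l j. matrix_unit i j \<otimes>\<^sub>o (a i k * b l j)"
  have zero: "0 \<otimes>\<^sub>o T = 0" for T :: "'b l2op"
    using tensor_op_sum_left[of _ "{}" T] by simp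
  have "block_matrix F a * block_matrix F b
      = (\<Sum>i\<in>F. \<Sum>l\<in>F. \<Sum>k\<in>F. \<Sum>j\<in>F. if k = l then ?E i k l j else 0)"
    unfolding block_matrix_def sum_product tensor_op_mult matrix_unit_mult
    by (intro sum.cong refl) (simp add: zero)
  also have "\<dots> = (\<Sum>i\<in>F. \<Sum>k\<in>F. \<Sum>j\<in>F. ?E i k k j)"
  proof (rule sum.cong[OF refl])
    fix i
    have "(\<Sum>l\<in>F. \<Sum>k\<in>F. \<Sum>j\<in>F. if k = l then ?E i k l j else 0)
        = (\<Sum>k\<in>F. \<Sum>l\<in>F. if k = l then (\<Sum>j\<in>F. ?E i k l j) else 0)"
      by (subst sum.swap) (intro sum.cong refl, simp)
    then show "(\<Sum>l\<in>F. \<Sum>k\<in>F. \<Sum>j\<in>F. if k = l then ?E i k l j else 0)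
        = (\<Sum>k\<in>F. \<Sum>j\<in>F. ?E i k k j)"
      using assms by simp
  qed
  also have "\<dots> = (\<Sum>i\<in>F. \<Sum>j\<in>F. \<Sum>k\<in>F. ?E i k k j)"
    by (rule sum.cong[OF refl], rule sum.swap)
  finally show ?thesis by (simp add: block_matrix_def tensor_op_sum_right)
qed

lemma star_block_matrix:
  assumes "finite F"
  shows "star (block_matrix F a) = block_matrix F (\<lambda>i j. star (a j i))"
  by (rule matrix_entry_eqI)
    (auto simp: split_paired_all matrix_entry_star matrix_entry_block_matrix assms)

lemma norm_block_le:
  assumes "finite F" "k \<in> F" "l \<in> F"
  shows "norm (a k l) \<le> norm (block_matrix F a)"
  by (rule norm_le_submatrix[where r = "Pair k" and s = "Pair l"])
    (use assms in \<open>auto simp: inj_on_def matrix_entry_block_matrix\<close>)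

lemma norm_matrix_unit_le: "norm (matrix_unit i j) \<le> 1"
  by (rule norm_l2op_bound) (simp_all add: matrix_unit_apply norm_scaleC ell2_apply_le_norm)

lemma star_rep_sum:
  assumes "star_rep \<sigma>"
  shows "\<sigma> (\<Sum>i\<in>I. x i) = (\<Sum>i\<in>I. \<sigma> (x i))"
proof -
  have add: "\<sigma> (x + y) = \<sigma> x + \<sigma> y" for x y using assms by (simp add: star_rep_def)
  have "\<sigma> 0 = 0" using add[of 0 0] by simp
  then show ?thesis by (induction I rule: infinite_finite_induct) (simp_all add: add)
qed

text \<open>
  A crude bound is enough here: applying a representation to each of the finitely many entries
  of a matrix is bounded, because each entry is bounded by the whole matrix.
\<close>

lemma norm_block_matrix_rep_crude:
  assumes "star_rep \<sigma>" "finite F"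
  shows "norm (block_matrix F (\<lambda>i j. \<sigma> (a i j))) \<le> (real (card F))\<^sup>2 * norm (block_matrix F a)"
proof -
  have "norm (block_matrix F (\<lambda>i j. \<sigma> (a i j))) \<le> (\<Sum>i\<in>F. \<Sum>j\<in>F. norm (block_matrix F a))"
    unfolding block_matrix_def[of F "\<lambda>i j. \<sigma> (a i j)"]
  proof (intro sum_norm_le)
    fix i j assume "i \<in> F" "j \<in> F"
    then have "norm (\<sigma> (a i j)) \<le> norm (block_matrix F a)"
      using star_rep_norm_le[OF assms(1), of "a i j"] norm_block_le[OF assms(2), of i j a] by linarith
    then show "norm (matrix_unit i j \<otimes>\<^sub>o \<sigma> (a i j)) \<le> norm (block_matrix F a)"
      using norm_tensor_op_bound[OF norm_matrix_unit_le] by fastforce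
  qed
  then show ?thesis by (simp add: power2_eq_square)
qed

lemma le_if_power_le:
  fixes x y K :: real
  assumes "0 \<le> x" and le: "\<And>n. y ^ 2 ^ n \<le> K * x ^ 2 ^ n"
  shows "y \<le> x"
proof (rule ccontr)
  assume "\<not> y \<le> x"
  show False
  proof (cases "x = 0")
    case True
    then show False using le[of 0] \<open>\<not> y \<le> x\<close> by simp
  next
    case False
    then have x: "0 < x" and yx: "1 < y / x" using assms(1) \<open>\<not> y \<le> x\<close> by auto
    then obtain n where "K < (y / x) ^ n" using real_arch_pow by blast
    also have "\<dots> \<le> (y / x) ^ 2 ^ n"
      using yx by (intro power_increasing) (auto intro: less_imp_le)
    also have "\<dots> \<le> K" using le[of n] x by (simp add: power_divide field_simps)
    finally show False by simp
  qed
qed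

text \<open>
  The constant disappears by the \<open>C\<^sup>*\<close>-identity: the entrywise application commutes with
  products and adjoints, so passing from \<open>a\<close> to \<open>a\<^sup>* a\<close> squares both norms while the constant
  stays the same.
\<close>

lemma norm_block_matrix_rep_le:
  assumes \<sigma>: "star_rep \<sigma>" and F: "finite F"
  shows "norm (block_matrix F (\<lambda>i j. \<sigma> (a i j))) \<le> norm (block_matrix F a)"
proof (rule le_if_power_le)
  fix n
  show "norm (block_matrix F (\<lambda>i j. \<sigma> (a i j))) ^ 2 ^ n
      \<le> (real (card F))\<^sup>2 * norm (block_matrix F a) ^ 2 ^ n"
  proof (induction n arbitrary: a)
    case 0
    show ?case using norm_block_matrix_rep_crude[OF assms] by simp
  next
    case (Suc n)
    define b where "b i j = (\<Sum>k\<in>F. star (a k i) * a k j)" for i j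
    have mult: "\<sigma> (x * y) = \<sigma> x * \<sigma> y" and st: "\<sigma> (star x) = star (\<sigma> x)" for x y
      using \<sigma> by (auto simp: star_rep_def)
    have "block_matrix F b = star (block_matrix F a) * block_matrix F a"
      unfolding star_block_matrix[OF F] block_matrix_mult[OF F] b_def ..
    then have 1: "norm (block_matrix F b) = (norm (block_matrix F a))\<^sup>2"
      by (simp add: norm_star_mult_self)
    have "block_matrix F (\<lambda>i j. \<sigma> (b i j))
        = star (block_matrix F (\<lambda>i j. \<sigma> (a i j))) * block_matrix F (\<lambda>i j. \<sigma> (a i j))"
      unfolding star_block_matrix[OF F] block_matrix_mult[OF F] b_def
      by (simp add: star_rep_sum[OF \<sigma>] mult st)
    then have 2: "norm (block_matrix F (\<lambda>i j. \<sigma> (b i j)))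
        = (norm (block_matrix F (\<lambda>i j. \<sigma> (a i j))))\<^sup>2"
      by (simp add: norm_star_mult_self)
    show ?case using Suc.IH[of b] unfolding 1 2 by (simp add: power_mult[symmetric])
  qed
qed simp

text \<open>
  Hence the norm of an elementary sum cannot grow when the identity representation of
  \<open>B(\<ell>\<^sup>2('m))\<close> is replaced by an arbitrary one, possibly vanishing on the compact operators:
  on each finite section of the first factor the sum is a matrix over \<open>B(\<ell>\<^sup>2('m))\<close>.
\<close>

lemma norm_sum_tensor_rep_le:
  fixes S :: "'i \<Rightarrow> 'k l2op" and x :: "'i \<Rightarrow> 'm l2op" and \<sigma> :: "'m l2op \<Rightarrow> 'h l2op"
  assumes \<sigma>: "star_rep \<sigma>"
  shows "norm (\<Sum>i\<in>I. S i \<otimes>\<^sub>o \<sigma> (x i)) \<le> norm (\<Sum>i\<in>I. S i \<otimes>\<^sub>o x i)"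
proof (rule norm_le_finite_sections)
  fix F :: "'k set" assume F: "finite F"
  define a where "a k l = (\<Sum>i\<in>I. matrix_entry (S i) k l *\<^sub>C x i)" for k l
  have \<sigma>a: "\<sigma> (a k l) = (\<Sum>i\<in>I. matrix_entry (S i) k l *\<^sub>C \<sigma> (x i))" for k l
    using \<sigma> by (simp add: a_def star_rep_sum[OF \<sigma>] star_rep_def)
  let ?W = "block_matrix F (\<lambda>k l. \<sigma> (a k l))"
  have "norm ?W \<le> norm (block_matrix F a)"
    by (rule norm_block_matrix_rep_le[OF \<sigma> F])
  also have "\<dots> \<le> norm (\<Sum>i\<in>I. S i \<otimes>\<^sub>o x i)"
    by (rule norm_le_rectangular[where R = "\<lambda>p q. fst p \<in> F \<and> fst q \<in> F"
          and r = "\<lambda>p. p" and s = "\<lambda>q. q"])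
      (auto simp: split_paired_all matrix_entry_block_matrix F a_def matrix_entry_sum
        matrix_entry_scaleC matrix_entry_tensor_op)
  finally have "norm ?W \<le> norm (\<Sum>i\<in>I. S i \<otimes>\<^sub>o x i)" .
  moreover have "matrix_entry ?W p q = (if fst p \<in> F \<and> fst q \<in> F
      then matrix_entry (\<Sum>i\<in>I. S i \<otimes>\<^sub>o \<sigma> (x i)) p q else 0)" for p q
    by (cases p, cases q) (simp add: matrix_entry_block_matrix F \<sigma>a matrix_entry_sum
        matrix_entry_scaleC matrix_entry_tensor_op)
  ultimately show "\<exists>W. norm W \<le> norm (\<Sum>i\<in>I. S i \<otimes>\<^sub>o x i) \<and>
      (\<forall>p q. matrix_entry W p q = (if fst p \<in> F \<and> fst q \<in> F
        then matrix_entry (\<Sum>i\<in>I. S i \<otimes>\<^sub>o \<sigma> (x i)) p q else 0))"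
    by blast
qed

section \<open>Spatial representations\<close>

definition l2op_embed :: "('m \<Rightarrow> 'n) \<Rightarrow> 'm l2op \<Rightarrow> 'n l2op" where
  "l2op_embed f T = (SOME U. \<forall>v. l2op_apply U v =
    ell2_pull (range f) (inv f) (l2op_apply T (ell2_pull UNIV f v)))"

lemma inj_on_inv_range: "inj_on (inv f) (range f)"
  by (rule inj_on_inv_into) simp

lemma l2op_embed_apply:
  assumes "inj f"
  shows "l2op_apply (l2op_embed f T) v =
    ell2_pull (range f) (inv f) (l2op_apply T (ell2_pull UNIV f v))"
proof -
  have "bounded_linear (\<lambda>v. ell2_pull (range f) (inv f) (l2op_apply T (ell2_pull UNIV f v)))"
    by (intro bounded_linear_compose[OF bounded_linear_ell2_pull]
        bounded_linear_compose[OF bounded_linear_l2op_apply] bounded_linear_ell2_pull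
        inj_on_inv_range assms)
  then obtain U where
    "l2op_apply U = (\<lambda>v. ell2_pull (range f) (inv f) (l2op_apply T (ell2_pull UNIV f v)))"
    by (rule l2op_exists[THEN exE])
      (simp_all add: ell2_pull_scaleC assms inj_on_inv_range l2op_apply_scaleC)
  then have "\<exists>U. \<forall>v. l2op_apply U v =
      ell2_pull (range f) (inv f) (l2op_apply T (ell2_pull UNIV f v))" by metis
  from someI_ex[OF this] show ?thesis unfolding l2op_embed_def by blast
qed

lemma matrix_entry_embed:
  assumes "inj f"
  shows "matrix_entry (l2op_embed f T) p q
    = (if p \<in> range f \<and> q \<in> range f then matrix_entry T (inv f p) (inv f q) else 0)"
proof -
  have "ell2_pull UNIV f (ket q) = (if q \<in> range f then ket (inv f q) else 0)"
  proof (cases "q \<in> range f")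
    case True
    then obtain j where "q = f j" by blast
    then show ?thesis
      by (intro ell2_eqI) (simp add: ell2_apply_pull assms ket.rep_eq inj_eq)
  next
    case False
    then have "f i \<noteq> q" for i by blast
    then show ?thesis
      using False by (intro ell2_eqI) (simp add: ell2_apply_pull assms ket.rep_eq zero_ell2.rep_eq)
  qed
  then show ?thesis
    by (simp add: matrix_entry_eq_apply l2op_embed_apply assms ell2_apply_pull inj_on_inv_range
        l2op_apply_zero zero_ell2.rep_eq)
qed

lemma matrix_entry_embed_image:
  "inj f \<Longrightarrow> matrix_entry (l2op_embed f T) (f i) (f j) = matrix_entry T i j"
  by (simp add: matrix_entry_embed)

lemma l2op_embed_mult:
  assumes "inj f"
  shows "l2op_embed f (S * T) = l2op_embed f S * l2op_embed f T"
proof -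
  have "ell2_pull UNIV f (ell2_pull (range f) (inv f) v) = v" for v
    by (rule ell2_eqI) (simp add: ell2_apply_pull assms inj_on_inv_range)
  then show ?thesis
    by (intro l2op_eqI) (simp add: l2op_embed_apply assms l2op_apply_mult)
qed

text \<open>
  An isometry \<open>V\<close> induced by an injection of index sets yields the representation
  \<open>T \<mapsto> V T V\<^sup>*\<close>, which is multiplicative because \<open>V\<^sup>* V = 1\<close>; up to unitary
  equivalence it is the identity representation plus a zero summand.
\<close>

lemma star_rep_embed:
  assumes "inj f"
  shows "star_rep (l2op_embed f)"
  unfolding star_rep_def
  by (intro conjI allI l2op_embed_mult assms; rule matrix_entry_eqI)
    (auto simp: matrix_entry_embed assms matrix_entry_add matrix_entry_scaleC matrix_entry_star)

definition ell2_cnj :: "'a ell2 \<Rightarrow> 'a ell2"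
  where "ell2_cnj v = Abs_ell2 (\<lambda>i. cnj (ell2_apply v i))"

lemma ell2_apply_cnj: "ell2_apply (ell2_cnj v) i = cnj (ell2_apply v i)"
  using ell2_square_summable[of v] by (simp add: ell2_cnj_def Abs_ell2_inverse)

lemma ell2_cnj_scaleC: "ell2_cnj (c *\<^sub>C v) = cnj c *\<^sub>C ell2_cnj v"
  by (rule ell2_eqI) (simp add: ell2_apply_cnj scaleC_ell2.rep_eq)

lemma bounded_linear_ell2_cnj: "bounded_linear ell2_cnj"
proof (rule bounded_linear_intro[of _ 1])
  show "ell2_cnj (v + w) = ell2_cnj v + ell2_cnj w" for v w :: "'a ell2"
    by (rule ell2_eqI) (simp add: ell2_apply_cnj plus_ell2.rep_eq)
  show "ell2_cnj (r *\<^sub>R v) = r *\<^sub>R ell2_cnj v" for r and v :: "'a ell2"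
    by (simp add: scaleR_scaleC ell2_cnj_scaleC)
  show "norm (ell2_cnj v) \<le> norm v * 1" for v :: "'a ell2"
    by (simp add: norm_ell2_def ell2_apply_cnj)
qed

definition l2op_cnj :: "'a l2op \<Rightarrow> 'a l2op" where
  "l2op_cnj T = (SOME U. \<forall>v. l2op_apply U v = ell2_cnj (l2op_apply T (ell2_cnj v)))"

lemma l2op_cnj_apply: "l2op_apply (l2op_cnj T) v = ell2_cnj (l2op_apply T (ell2_cnj v))"
proof -
  have "bounded_linear (\<lambda>v. ell2_cnj (l2op_apply T (ell2_cnj v)))"
    by (intro bounded_linear_compose[OF bounded_linear_ell2_cnj]
        bounded_linear_compose[OF bounded_linear_l2op_apply] bounded_linear_ell2_cnj)
  then obtain U where "l2op_apply U = (\<lambda>v. ell2_cnj (l2op_apply T (ell2_cnj v)))"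
    by (rule l2op_exists[THEN exE]) (simp_all add: ell2_cnj_scaleC l2op_apply_scaleC)
  then have "\<exists>U. \<forall>v. l2op_apply U v = ell2_cnj (l2op_apply T (ell2_cnj v))" by metis
  from someI_ex[OF this] show ?thesis unfolding l2op_cnj_def by blast
qed

lemma matrix_entry_cnj: "matrix_entry (l2op_cnj T) i j = cnj (matrix_entry T i j)"
proof -
  have "ell2_cnj (ket j) = ket j"
    by (rule ell2_eqI) (simp add: ell2_apply_cnj ket.rep_eq)
  then show ?thesis by (simp add: matrix_entry_eq_apply l2op_cnj_apply ell2_apply_cnj)
qed

lemma l2op_cnj_add: "l2op_cnj (S + T) = l2op_cnj S + l2op_cnj T"
  by (rule matrix_entry_eqI) (simp add: matrix_entry_cnj matrix_entry_add)

lemma l2op_cnj_scaleC: "l2op_cnj (c *\<^sub>C T) = cnj c *\<^sub>C l2op_cnj T"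
  by (rule matrix_entry_eqI) (simp add: matrix_entry_cnj matrix_entry_scaleC)

lemma l2op_cnj_star: "l2op_cnj (star T) = star (l2op_cnj T)"
  by (rule matrix_entry_eqI) (simp add: matrix_entry_cnj matrix_entry_star)

lemma l2op_cnj_mult: "l2op_cnj (S * T) = l2op_cnj S * l2op_cnj T"
proof -
  have "ell2_cnj (ell2_cnj v) = v" for v :: "'a ell2"
    by (rule ell2_eqI) (simp add: ell2_apply_cnj)
  then show ?thesis by (intro l2op_eqI) (simp add: l2op_cnj_apply l2op_apply_mult)
qed

lemma l2op_cnj_hankel: "l2op_cnj (hankel t) = hankel t"
  by (rule matrix_entry_eqI) (simp add: matrix_entry_cnj matrix_entry_hankel)

text \<open>
  Entrywise conjugation is the conjugate-linear isomorphism that identifies the complex conjugate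
  of \<open>B(\<ell>\<^sup>2('m))\<close> with \<open>B(\<ell>\<^sup>2('m))\<close>; representations are transported along it both ways.
\<close>

lemma star_rep_from_cconj:
  assumes "star_rep (\<tau> :: 'm l2op cconj \<Rightarrow> 'h l2op)"
  shows "star_rep (\<lambda>T. \<tau> (to_cconj (l2op_cnj T)))"
  using assms
  by (simp add: star_rep_def l2op_cnj_add l2op_cnj_scaleC l2op_cnj_star l2op_cnj_mult
      plus_cconj.abs_eq[symmetric] scaleC_cconj.abs_eq[symmetric] times_cconj.abs_eq[symmetric]
      star_cconj.abs_eq[symmetric])

lemma star_rep_to_cconj:
  assumes "star_rep (\<rho> :: 'm l2op \<Rightarrow> 'h l2op)"
  shows "star_rep (\<lambda>T. \<rho> (l2op_cnj (of_cconj T)))"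
  using assms
  by (simp add: star_rep_def l2op_cnj_add l2op_cnj_scaleC l2op_cnj_star l2op_cnj_mult
      plus_cconj.rep_eq scaleC_cconj.rep_eq times_cconj.rep_eq star_cconj.rep_eq)

section \<open>Self-absorption of the Hankel system\<close>

lemma inj_hankel: "inj (hankel :: 'm::cancellative_monoid \<Rightarrow> 'm l2op)"
proof (rule injI)
  fix s t :: 'm assume "hankel s = hankel t"
  then have "matrix_entry (hankel s) s 1 = matrix_entry (hankel t) s 1" by simp
  then show "s = t" by (simp add: matrix_entry_hankel split: if_splits)
qed

text \<open>
  The matrix of \<open>\<Sum>t. S t \<otimes> \<Gamma>\<^sub>t \<otimes> \<Gamma>\<^sub>t\<close> lives on the pairs \<open>(a, b)\<close>, \<open>(x, y)\<close> with \<open>a x = b y\<close>,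
  and the lunar condition says precisely that this relation is a disjoint union of rectangles.
  There its entry is the entry of \<open>\<Sum>t. S t \<otimes> \<Gamma>\<^sub>t\<close> at \<open>a\<close>, \<open>x\<close>, and by cancellation the second
  coordinate is determined by the first on each side of a rectangle.
\<close>

lemma norm_hankel_square_le:
  fixes S :: "'m::cancellative_monoid \<Rightarrow> 'k l2op"
  assumes lunar: "\<And>a b c d x y z w :: 'm.
    a * x = b * y \<Longrightarrow> c * x = d * y \<Longrightarrow> a * z = b * w \<Longrightarrow> c * z = d * w"
  shows "norm (\<Sum>t\<in>I. (S t \<otimes>\<^sub>o hankel t) \<otimes>\<^sub>o hankel t) \<le> norm (\<Sum>t\<in>I. S t \<otimes>\<^sub>o hankel t)"
proof (rule norm_le_rectangular[where r = fst and s = fst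
      and R = "\<lambda>p q. snd (fst p) * snd (fst q) = snd p * snd q"])
  have left: "b = d" if "a * b = a * d" for a b d :: 'm
    using that cancellative[of a b 1 d] by simp
  have right: "b = d" if "b * c = d * c" for b c d :: 'm
    using that cancellative[of 1 b c d] by simp
  fix p q p' q' :: "('k \<times> 'm) \<times> 'm"
  show "matrix_entry (\<Sum>t\<in>I. (S t \<otimes>\<^sub>o hankel t) \<otimes>\<^sub>o hankel t) p q
      = (if snd (fst p) * snd (fst q) = snd p * snd q
         then matrix_entry (\<Sum>t\<in>I. S t \<otimes>\<^sub>o hankel t) (fst p) (fst q) else 0)"
    by (cases p, cases "fst p", cases q, cases "fst q")
      (auto simp: matrix_entry_sum matrix_entry_tensor_op matrix_entry_hankel
        intro!: sum.cong sum.neutral)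
  assume R: "snd (fst p) * snd (fst q) = snd p * snd q"
  show "snd (fst p') * snd (fst q') = snd p' * snd q'"
    if "snd (fst p') * snd (fst q) = snd p' * snd q" "snd (fst p) * snd (fst q') = snd p * snd q'"
    using R that by (rule lunar)
  show "q = q'" if "snd (fst p) * snd (fst q') = snd p * snd q'" "fst q = fst q'"
    using R that left[of "snd p" "snd q" "snd q'"] by (simp add: prod_eq_iff)
  show "p = p'" if "snd (fst p') * snd (fst q) = snd p' * snd q" "fst p = fst p'"
    using R that right[of "snd p" "snd q" "snd p'"] by (simp add: prod_eq_iff)
qed

text \<open>The contraction lemma changes only the last tensor factor, so each factor is moved there in turn.\<close>

lemma norm_rep_hankel_square_le:
  fixes S :: "'m::cancellative_monoid \<Rightarrow> 'k l2op" and \<sigma> :: "'m l2op \<Rightarrow> 'h l2op"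
    and \<tau> :: "'m l2op \<Rightarrow> 'g l2op"
  assumes "star_rep \<sigma>" "star_rep \<tau>"
  shows "norm (\<Sum>t\<in>I. S t \<otimes>\<^sub>o \<sigma> (hankel t) \<otimes>\<^sub>o \<tau> (hankel t))
    \<le> norm (\<Sum>t\<in>I. (S t \<otimes>\<^sub>o hankel t) \<otimes>\<^sub>o hankel t)"
proof -
  have "norm (\<Sum>t\<in>I. S t \<otimes>\<^sub>o \<sigma> (hankel t) \<otimes>\<^sub>o \<tau> (hankel t))
      \<le> norm (\<Sum>t\<in>I. (S t \<otimes>\<^sub>o \<sigma> (hankel t)) \<otimes>\<^sub>o \<tau> (hankel t))"
    by (rule norm_le_submatrix[where r = "\<lambda>(i, j, k). ((i, j), k)" and s = "\<lambda>(i, j, k). ((i, j), k)"])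
      (auto simp: inj_on_def matrix_entry_sum matrix_entry_tensor_op mult.assoc)
  also have "\<dots> \<le> norm (\<Sum>t\<in>I. (S t \<otimes>\<^sub>o \<sigma> (hankel t)) \<otimes>\<^sub>o hankel t)"
    by (rule norm_sum_tensor_rep_le[OF assms(2)])
  also have "\<dots> \<le> norm (\<Sum>t\<in>I. (S t \<otimes>\<^sub>o hankel t) \<otimes>\<^sub>o \<sigma> (hankel t))"
    by (rule norm_le_submatrix[where r = "\<lambda>((i, j), k). ((i, k), j)" and s = "\<lambda>((i, j), k). ((i, k), j)"])
      (auto simp: inj_on_def matrix_entry_sum matrix_entry_tensor_op ac_simps)
  also have "\<dots> \<le> norm (\<Sum>t\<in>I. (S t \<otimes>\<^sub>o hankel t) \<otimes>\<^sub>o hankel t)"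
    by (rule norm_sum_tensor_rep_le[OF assms(1)])
  finally show ?thesis .
qed

theorem theorem1:
  assumes lunar: "\<And>a b c d x y z w :: 'm::cancellative_monoid.
    a * x = b * y \<Longrightarrow> c * x = d * y \<Longrightarrow> a * z = b * w \<Longrightarrow> c * z = d * w"
  shows "SAP TYPE('b::cstar_algebra) (hankel :: 'm \<Rightarrow> 'm l2op)"
  unfolding SAP_def
proof (intro allI impI)
  fix b :: "'m \<Rightarrow> 'b"
  define I where "I = {i. b i \<noteq> 0}"
  let ?c = "\<lambda>t :: 'm. to_cconj (hankel t)"
  let ?f = "hankel :: 'm \<Rightarrow> 'm l2op"
  \<comment> \<open>The suprema use representations on \<open>\<ell>\<^sup>2\<close> of the algebras themselves; \<open>hankel\<close> serves as a
    convenient injection of the monoid into their elements.\<close>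
  have inj_c: "inj ?c"
    using inj_hankel by (auto simp: inj_on_def to_cconj_inject)
  define \<sigma>\<^sub>0 where "\<sigma>\<^sub>0 = l2op_embed ?f"
  define \<tau>\<^sub>0 where "\<tau>\<^sub>0 T = l2op_embed ?c (l2op_cnj (of_cconj T))" for T
  have \<sigma>\<^sub>0: "star_rep \<sigma>\<^sub>0" unfolding \<sigma>\<^sub>0_def by (rule star_rep_embed[OF inj_hankel])
  have \<tau>\<^sub>0: "star_rep \<tau>\<^sub>0"
    unfolding \<tau>\<^sub>0_def by (rule star_rep_to_cconj[OF star_rep_embed[OF inj_c]])
  have entry_\<sigma>\<^sub>0: "matrix_entry (\<sigma>\<^sub>0 (hankel t)) (?f i) (?f j) = matrix_entry (hankel t) i j" for t i j
    by (simp add: \<sigma>\<^sub>0_def matrix_entry_embed_image inj_hankel)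
  have entry_\<tau>\<^sub>0: "matrix_entry (\<tau>\<^sub>0 (?c t)) (?c i) (?c j) = matrix_entry (hankel t) i j" for t i j
    using matrix_entry_embed_image[OF inj_c, of "hankel t" i j]
    by (simp add: \<tau>\<^sub>0_def to_cconj_inverse l2op_cnj_hankel)
  have "min_norm2 I b hankel \<le> min_norm3 I b hankel ?c"
    unfolding min_norm2_def
  proof (rule cSup_least[OF min_norm2_set(2)], clarify)
    fix \<rho> :: "'b \<Rightarrow> 'b l2op" and \<sigma> :: "'m l2op \<Rightarrow> 'm l2op l2op"
    assume reps: "star_rep \<rho>" "star_rep \<sigma>"
    have "norm (\<Sum>t\<in>I. \<rho> (b t) \<otimes>\<^sub>o \<sigma> (hankel t)) \<le> norm (\<Sum>t\<in>I. \<rho> (b t) \<otimes>\<^sub>o hankel t)"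
      by (rule norm_sum_tensor_rep_le[OF reps(2)])
    also have "\<dots> \<le> norm (\<Sum>t\<in>I. \<rho> (b t) \<otimes>\<^sub>o \<sigma>\<^sub>0 (hankel t) \<otimes>\<^sub>o \<tau>\<^sub>0 (?c t))"
      \<comment> \<open>On the diagonal, the square of a matrix entry \<open>0\<close> or \<open>1\<close> is that entry.\<close>
      by (rule norm_le_submatrix[where r = "\<lambda>(i, a). (i, ?f a, ?c a)" and s = "\<lambda>(i, a). (i, ?f a, ?c a)"])
        (auto simp: inj_on_def injD[OF inj_hankel] matrix_entry_sum matrix_entry_tensor_op
          entry_\<sigma>\<^sub>0 entry_\<tau>\<^sub>0 matrix_entry_hankel_square)
    also have "\<dots> \<le> min_norm3 I b hankel ?c"
      unfolding min_norm3_def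
      by (rule cSup_upper[OF _ min_norm3_set(1)]) (use reps \<sigma>\<^sub>0 \<tau>\<^sub>0 in blast)
    finally show "norm (\<Sum>t\<in>I. \<rho> (b t) \<otimes>\<^sub>o \<sigma> (hankel t)) \<le> min_norm3 I b hankel ?c" .
  qed
  moreover have "min_norm3 I b hankel ?c \<le> min_norm2 I b hankel"
    unfolding min_norm3_def
  proof (rule cSup_least[OF min_norm3_set(2)], clarify)
    fix \<rho> :: "'b \<Rightarrow> 'b l2op" and \<sigma> :: "'m l2op \<Rightarrow> 'm l2op l2op"
      and \<tau> :: "'m l2op cconj \<Rightarrow> 'm l2op cconj l2op"
    assume reps: "star_rep \<rho>" "star_rep \<sigma>" "star_rep \<tau>"
    have "norm (\<Sum>t\<in>I. \<rho> (b t) \<otimes>\<^sub>o \<sigma> (hankel t) \<otimes>\<^sub>o \<tau> (?c t))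
        \<le> norm (\<Sum>t\<in>I. (\<rho> (b t) \<otimes>\<^sub>o hankel t) \<otimes>\<^sub>o hankel t)"
      using norm_rep_hankel_square_le[OF reps(2) star_rep_from_cconj[OF reps(3)],
          where S = "\<lambda>t. \<rho> (b t)" and I = I]
      by (simp add: l2op_cnj_hankel)
    also have "\<dots> \<le> norm (\<Sum>t\<in>I. \<rho> (b t) \<otimes>\<^sub>o hankel t)"
      by (rule norm_hankel_square_le) (rule lunar)
    also have "\<dots> \<le> norm (\<Sum>t\<in>I. \<rho> (b t) \<otimes>\<^sub>o \<sigma>\<^sub>0 (hankel t))"
      by (rule norm_le_submatrix[where r = "\<lambda>(i, a). (i, ?f a)" and s = "\<lambda>(i, a). (i, ?f a)"])
        (auto simp: inj_on_def injD[OF inj_hankel] matrix_entry_sum matrix_entry_tensor_op entry_\<sigma>\<^sub>0)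
    also have "\<dots> \<le> min_norm2 I b hankel"
      unfolding min_norm2_def
      by (rule cSup_upper[OF _ min_norm2_set(1)]) (use reps \<sigma>\<^sub>0 in blast)
    finally show "norm (\<Sum>t\<in>I. \<rho> (b t) \<otimes>\<^sub>o \<sigma> (hankel t) \<otimes>\<^sub>o \<tau> (?c t)) \<le> min_norm2 I b hankel" .
  qed
  ultimately show "min_norm2 {i. b i \<noteq> 0} b hankel = min_norm3 {i. b i \<noteq> 0} b hankel ?c"
    unfolding I_def by (rule antisym)
qed

end
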